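(* There exists a sequence of two-party functions $F_j:\mathcal{X}_j\times\mathcal{Y}_j\to\{0,1\}$ with $\log\chi(F_j)\to\infty$ such that $D^{\mathrm{cc}}(F_j)\geq \bigl(\log\chi(F_j)\bigr)^{2-o(1)}$, i.e. $D^{\mathrm{cc}}(F_j)\geq \bigl(\log\chi(F_j)\bigr)^{2-\epsilon_j}$ for some sequence $\epsilon_j\to 0$.
   Context: For $F:\mathcal{X}\times\mathcal{Y}\to\{0,1\}$, where Alice holds $x\in\mathcal{X}$ and Bob holds $y\in\mathcal{Y}$, $D^{\mathrm{cc}}(F)$ is the deterministic communication complexity: the number of bits communicated in the worst case by the best deterministic two-party protocol computing $F$. A rectangle is a set $A\times B$ with $A\subseteq\mathcal{X}$, $B\subseteq\mathcal{Y}$; it is monochromatic if $F$ is constant on it. The partition number $\chi(F)$ is the least number of monochromatic rectangles in a partition (disjoint cover) of $\mathcal{X}\times\mathcal{Y}$. Logarithms are base 2. *)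

theory Defs
  imports Complex_Main "HOL-Library.Disjoint_Sets"
begin

text \<open>
  A function \<open>F : X \<times> Y \<rightarrow> {0,1}\<close> is given by the sets \<open>X\<close>, \<open>Y\<close> and a curried boolean function;
  its values outside \<open>X \<times> Y\<close> are irrelevant to all the notions below.

  In a node \<open>Alice f P Q\<close> Alice sends the bit \<open>f x\<close>, and the protocol continues with \<open>P\<close> if the bit
  is true and with \<open>Q\<close> otherwise. Leaves carry the output, so the transcript determines it.
\<close>

datatype ('a, 'b) protocol =
    Output bool
  | Alice "'a \<Rightarrow> bool" "('a, 'b) protocol" "('a, 'b) protocol"
  | Bob "'b \<Rightarrow> bool" "('a, 'b) protocol" "('a, 'b) protocol"

primrec run :: "('a, 'b) protocol \<Rightarrow> 'a \<Rightarrow> 'b \<Rightarrow> bool" where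
  "run (Output c) x y = c"
| "run (Alice f P Q) x y = (if f x then run P x y else run Q x y)"
| "run (Bob g P Q) x y = (if g y then run P x y else run Q x y)"

primrec bits :: "('a, 'b) protocol \<Rightarrow> 'a \<Rightarrow> 'b \<Rightarrow> nat" where
  "bits (Output c) x y = 0"
| "bits (Alice f P Q) x y = Suc (if f x then bits P x y else bits Q x y)"
| "bits (Bob g P Q) x y = Suc (if g y then bits P x y else bits Q x y)"

definition computes :: "('a, 'b) protocol \<Rightarrow> 'a set \<Rightarrow> 'b set \<Rightarrow> ('a \<Rightarrow> 'b \<Rightarrow> bool) \<Rightarrow> bool" where
  "computes P X Y F \<longleftrightarrow> (\<forall>x\<in>X. \<forall>y\<in>Y. run P x y = F x y)"

text \<open>For finite \<open>X\<close> and \<open>Y\<close> the sets minimised over in the next definition and in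
  \<open>partition_number\<close> are nonempty; otherwise these two values may be meaningless.\<close>

definition Dcc :: "'a set \<Rightarrow> 'b set \<Rightarrow> ('a \<Rightarrow> 'b \<Rightarrow> bool) \<Rightarrow> nat" where
  "Dcc X Y F = (LEAST d. \<exists>P. computes P X Y F \<and> (\<forall>x\<in>X. \<forall>y\<in>Y. bits P x y \<le> d))"

definition monochromatic_rectangle ::
  "'a set \<Rightarrow> 'b set \<Rightarrow> ('a \<Rightarrow> 'b \<Rightarrow> bool) \<Rightarrow> ('a \<times> 'b) set \<Rightarrow> bool" where
  "monochromatic_rectangle X Y F R \<longleftrightarrow>
     (\<exists>A B. A \<subseteq> X \<and> B \<subseteq> Y \<and> R = A \<times> B \<and> (\<exists>c. \<forall>x\<in>A. \<forall>y\<in>B. F x y = c))"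

definition partition_number :: "'a set \<Rightarrow> 'b set \<Rightarrow> ('a \<Rightarrow> 'b \<Rightarrow> bool) \<Rightarrow> nat" where
  "partition_number X Y F =
     (LEAST n. \<exists>\<R>. finite \<R> \<and> card \<R> = n \<and> partition_on (X \<times> Y) \<R> \<and>
        (\<forall>R\<in>\<R>. monochromatic_rectangle X Y F R))"

end

theory Submission
  imports Defs "HOL-Library.FuncSet" "HOL-Library.Nat_Bijection"
begin

text \<open>
  Let \<open>D\<close> be the deterministic query complexity of a function, \<open>C\<close> its certificate complexity and
  \<open>U\<close> its unambiguous certificate complexity, for both output values. If these are \<open>n^(2k)\<close>, \<open>n^k\<close>,
  \<open>n^(k+1)\<close> up to polylogarithmic factors, then adding a cheat sheet leaves \<open>D\<close>, \<open>C\<close>, \<open>U\<close> unchanged but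
  makes the unambiguous certificates of the 1-inputs as short as \<open>C\<close>. Taking an OR of \<open>n\<close> ANDs of
  \<open>n\<close> copies of the result multiplies \<open>D\<close> by \<open>n^2\<close>, but \<open>C\<close> and \<open>U\<close> only by \<open>n\<close>. Hence the exponent
  \<open>2k / (k+1)\<close> is attained for every \<open>k\<close>, starting from a single variable (Ambainis, Kokainis, Kothari).

  Every variable is then replaced by an index gadget \<open>x i \<in> y i\<close> with \<open>x i < m\<close> and \<open>y i \<subseteq> {..<m}\<close> for a
  polynomially large \<open>m\<close>. Unambiguous certificates become disjoint monochromatic rectangles, and the
  simulation theorem of Raz and McKenzie shows that the communication complexity is at least \<open>D\<close>: a
  rectangle whose projections to the unqueried coordinates are large on Bob's side and of large
  minimum degree on Alice's side still contains every value of these coordinates, a bit sent by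
  Alice lowers the logarithmic density of her side by at most 2 after pruning, and a query, which is
  made only in a coordinate of small average degree, raises it by 2.
\<close>

section \<open>Query complexity\<close>

text \<open>The gadget costs only O(log n) per literal as long as the number of variables stays
  polynomial in \<open>n\<close>. Cheat sheets respect this: \<open>t\<close> of about 2k log n
  gives enough cells for \<open>n ^ (2 * k)\<close> queries to leave one untouched, but only
  polynomially many. The n-by-n shape of the OR of ANDs comes from balance. After the cheat sheet,
  1-certificates have length about n^k and unambiguous 0-certificates about n^(k+1); listing blocks
  pays n^2 times the former and n times the latter, and both are n^(k+2). Each round adds a
  polylogarithmic factor whose degree grows with the number of rounds. Therefore \<open>k\<close> is
  fixed first, and \<open>n = 2 ^ l\<close> is then chosen so large that the total overhead is below
  \<open>n\<close>.

  The accounting for Alice has no counterpart for Bob: his deficit grows with his bits and by 2 per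
  query, and is never repaid. It only has to stay below \<open>k0\<close>, which is affordable
  because each of his coordinates carries \<open>m\<close> bits, far more than
  \<open>k0\<close>.\<close>

text \<open>An adversary who keeps the input inside \<open>Z\<close> can answer any \<open>q - 1\<close> queries and leave \<open>f\<close>
  undetermined. Here \<open>Z\<close> is the set of inputs consistent with the answers so far.\<close>

primrec hard :: "((nat \<Rightarrow> bool) \<Rightarrow> bool) \<Rightarrow> nat \<Rightarrow> (nat \<Rightarrow> bool) set \<Rightarrow> bool" where
  "hard f 0 Z \<longleftrightarrow> True"
| "hard f (Suc q) Z \<longleftrightarrow>
     (\<exists>z\<in>Z. f z) \<and> (\<exists>z\<in>Z. \<not> f z) \<and> (\<forall>i. \<exists>b. hard f q {z \<in> Z. z i = b})"

text \<open>Lists of literals can be concatenated, counted and coded in bit strings. Repetitions are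
  allowed, and so are contradictions; a contradictory list is satisfied by no input.\<close>

type_synonym cert = "(nat \<times> bool) list"

definition sat :: "(nat \<Rightarrow> bool) \<Rightarrow> cert \<Rightarrow> bool" where
  "sat z c \<longleftrightarrow> (\<forall>(i, b)\<in>set c. z i = b)"

definition certifiable :: "((nat \<Rightarrow> bool) \<Rightarrow> bool) \<Rightarrow> nat set \<Rightarrow> nat \<Rightarrow> nat \<Rightarrow> bool" where
  "certifiable f V w0 w1 \<longleftrightarrow> (\<exists>c. \<forall>z. sat z (c z) \<and> fst ` set (c z) \<subseteq> V \<and>
     length (c z) \<le> (if f z then w1 else w0) \<and> (\<forall>z'. sat z' (c z) \<longrightarrow> f z' = f z))"

text \<open>The requirement \<open>c z' = c z\<close> makes the subcubes given by the certificates disjoint.\<close>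

definition unambiguous :: "((nat \<Rightarrow> bool) \<Rightarrow> bool) \<Rightarrow> nat set \<Rightarrow> nat \<Rightarrow> nat \<Rightarrow> bool" where
  "unambiguous f V w0 w1 \<longleftrightarrow> (\<exists>c. \<forall>z. sat z (c z) \<and> fst ` set (c z) \<subseteq> V \<and>
     length (c z) \<le> (if f z then w1 else w0) \<and> (\<forall>z'. sat z' (c z) \<longrightarrow> f z' = f z \<and> c z' = c z))"

lemma certifiableE:
  assumes "certifiable f V w0 w1"
  obtains c where "\<And>z. sat z (c z)" "\<And>z. fst ` set (c z) \<subseteq> V"
    "\<And>z. length (c z) \<le> (if f z then w1 else w0)" "\<And>z z'. sat z' (c z) \<Longrightarrow> f z' = f z"
proof -
  obtain c where c: "\<forall>z. sat z (c z) \<and> fst ` set (c z) \<subseteq> V \<and>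
     length (c z) \<le> (if f z then w1 else w0) \<and> (\<forall>z'. sat z' (c z) \<longrightarrow> f z' = f z)"
    using assms unfolding certifiable_def by (elim exE)
  show thesis by (rule that[of c]) (use c in blast)+
qed

lemma unambiguousE:
  assumes "unambiguous f V w0 w1"
  obtains c where "\<And>z. sat z (c z)" "\<And>z. fst ` set (c z) \<subseteq> V"
    "\<And>z. length (c z) \<le> (if f z then w1 else w0)" "\<And>z z'. sat z' (c z) \<Longrightarrow> f z' = f z \<and> c z' = c z"
proof -
  obtain c where c: "\<forall>z. sat z (c z) \<and> fst ` set (c z) \<subseteq> V \<and>
     length (c z) \<le> (if f z then w1 else w0) \<and> (\<forall>z'. sat z' (c z) \<longrightarrow> f z' = f z \<and> c z' = c z)"
    using assms unfolding unambiguous_def by (elim exE)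
  show thesis by (rule that[of c]) (use c in blast)+
qed

lemma certifiableI:
  assumes "\<And>z. sat z (c z)" "\<And>z. fst ` set (c z) \<subseteq> V"
    "\<And>z. length (c z) \<le> (if f z then w1 else w0)" "\<And>z z'. sat z' (c z) \<Longrightarrow> f z' = f z"
  shows "certifiable f V w0 w1"
  unfolding certifiable_def by (intro exI[of _ c] allI conjI impI) (use assms in simp_all)

lemma unambiguousI:
  assumes "\<And>z. sat z (c z)" "\<And>z. fst ` set (c z) \<subseteq> V"
    "\<And>z. length (c z) \<le> (if f z then w1 else w0)" "\<And>z z'. sat z' (c z) \<Longrightarrow> f z' = f z \<and> c z' = c z"
  shows "unambiguous f V w0 w1"
  unfolding unambiguous_def by (intro exI[of _ c] allI conjI impI) (use assms in simp_all)

lemma certifiable_mono: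
  assumes "certifiable f V w0 w1" "w0 \<le> w0'" "w1 \<le> w1'"
  shows "certifiable f V w0' w1'"
proof (rule certifiableE[OF assms(1)])
  fix c
  assume c: "\<And>z. sat z (c z)" "\<And>z. fst ` set (c z) \<subseteq> V"
    "\<And>z. length (c z) \<le> (if f z then w1 else w0)" "\<And>z z'. sat z' (c z) \<Longrightarrow> f z' = f z"
  have "length (c z) \<le> (if f z then w1' else w0')" for z using c(3)[of z] assms(2,3) by (cases "f z") auto
  then show ?thesis by (rule certifiableI[OF c(1,2) _ c(4)])
qed

lemma unambiguous_mono:
  assumes "unambiguous f V w0 w1" "w0 \<le> w0'" "w1 \<le> w1'"
  shows "unambiguous f V w0' w1'"
proof (rule unambiguousE[OF assms(1)])
  fix c
  assume c: "\<And>z. sat z (c z)" "\<And>z. fst ` set (c z) \<subseteq> V"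
    "\<And>z. length (c z) \<le> (if f z then w1 else w0)" "\<And>z z'. sat z' (c z) \<Longrightarrow> f z' = f z \<and> c z' = c z"
  have "length (c z) \<le> (if f z then w1' else w0')" for z using c(3)[of z] assms(2,3) by (cases "f z") auto
  then show ?thesis by (rule unambiguousI[OF c(1,2) _ c(4)])
qed

text \<open>\<open>prod_encode\<close> splits the variables into infinitely many blocks, each again
  indexed by all naturals. So a composed function has the type of its components, and the rounds can
  be iterated.\<close>

definition block :: "(nat \<Rightarrow> bool) \<Rightarrow> nat \<Rightarrow> nat \<Rightarrow> bool" where
  "block z j i = z (prod_encode (j, i))"

definition in_block :: "nat \<Rightarrow> cert \<Rightarrow> cert" where
  "in_block j c = map (\<lambda>(i, b). (prod_encode (j, i), b)) c"

section \<open>Certificates assembled from blocks\<close>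

lemma sat_Nil [simp]: "sat z []"
  by (simp add: sat_def)

lemma sat_append [simp]: "sat z (c @ c') \<longleftrightarrow> sat z c \<and> sat z c'"
  by (auto simp: sat_def)

lemma sat_concat [simp]: "sat z (concat cs) \<longleftrightarrow> (\<forall>c\<in>set cs. sat z c)"
  by (auto simp: sat_def)

lemma sat_in_block [simp]: "sat z (in_block j c) \<longleftrightarrow> sat (block z j) c"
  by (auto simp: sat_def in_block_def block_def)

lemma length_in_block [simp]: "length (in_block j c) = length c"
  by (simp add: in_block_def)

lemma vars_in_block: "fst ` set c \<subseteq> V \<Longrightarrow> j \<in> J \<Longrightarrow> fst ` set (in_block j c) \<subseteq> prod_encode ` (J \<times> V)"
  by (force simp: in_block_def)

lemma length_concat_blocks_le:
  assumes "\<And>j. j < n \<Longrightarrow> length (F j) \<le> w"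
  shows "length (concat (map F [0..<n])) \<le> n * w"
  using assms
proof (induction n)
  case (Suc n)
  then have "length (concat (map F [0..<n])) \<le> n * w" "length (F n) \<le> w" by auto
  then show ?case by simp
qed simp

lemma vars_concat_blocks:
  "(\<And>j. j < n \<Longrightarrow> fst ` set (F j) \<subseteq> V) \<Longrightarrow> fst ` set (concat (map F [0..<n])) \<subseteq> V"
  by (fastforce simp: image_subset_iff)

lemma hard_SucD: "hard f (Suc q) Z \<Longrightarrow> hard f q Z"
proof (induction q arbitrary: Z)
  case (Suc q)
  have "\<exists>b. hard f q {z \<in> Z. z i = b}" for i
  proof -
    obtain b where "hard f (Suc q) {z \<in> Z. z i = b}"
      using Suc.prems unfolding hard.simps(2)[of f "Suc q"] by blast
    then show ?thesis using Suc.IH by blast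
  qed
  then show ?case using Suc.prems unfolding hard.simps(2) by blast
qed simp

lemma hardE_value:
  assumes "hard f (Suc q) Z" obtains z where "z \<in> Z" "f z = b"
  using assms by (cases b) auto

lemma block_merge: "block (\<lambda>v. y (fst (prod_decode v)) (snd (prod_decode v))) j = y j"
  by (simp add: block_def fun_eq_iff)

subsection \<open>NAND composition\<close>

text \<open>NAND exchanges the roles of the two kinds of certificates, so one lemma per complexity
  measure, applied twice, covers both levels of the tree.\<close>

definition nand :: "nat \<Rightarrow> ((nat \<Rightarrow> bool) \<Rightarrow> bool) \<Rightarrow> (nat \<Rightarrow> bool) \<Rightarrow> bool" where
  "nand n g z \<longleftrightarrow> \<not> (\<forall>j<n. g (block z j))"

definition block_vars :: "nat \<Rightarrow> nat set \<Rightarrow> nat set" where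
  "block_vars n V = prod_encode ` ({..<n} \<times> V)"

lemma finite_block_vars: "finite V \<Longrightarrow> finite (block_vars n V)"
  by (simp add: block_vars_def)

lemma card_block_vars_le: "finite V \<Longrightarrow> card (block_vars n V) \<le> n * card V"
  unfolding block_vars_def by (rule order_trans[OF card_image_le]) (auto simp: card_cartesian_product)

lemma certifiable_nand:
  assumes "certifiable g V w0 w1"
  shows "certifiable (nand n g) (block_vars n V) (n * w1) w0"
proof -
  obtain c where c: "\<And>z. sat z (c z)" "\<And>z. fst ` set (c z) \<subseteq> V"
    "\<And>z. length (c z) \<le> (if g z then w1 else w0)" "\<And>z z'. sat z' (c z) \<Longrightarrow> g z' = g z"
    using certifiableE[OF assms] by blast
  define p where "p z = (SOME j. j < n \<and> \<not> g (block z j))" for z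
  have p: "p z < n \<and> \<not> g (block z (p z))" if "nand n g z" for z
  proof -
    have "\<exists>j. j < n \<and> \<not> g (block z j)" using that by (auto simp: nand_def)
    then show ?thesis unfolding p_def by (rule someI_ex)
  qed
  define c' where "c' z = (if nand n g z then in_block (p z) (c (block z (p z)))
    else concat (map (\<lambda>j. in_block j (c (block z j))) [0..<n]))" for z
  have len: "length (c' z) \<le> (if nand n g z then w0 else n * w1)" for z
  proof (cases "nand n g z")
    case True then show ?thesis using c(3)[of "block z (p z)"] p[OF True] by (simp add: c'_def)
  next
    case False
    then have "length (c (block z j)) \<le> w1" if "j < n" for j
      using c(3)[of "block z j"] that by (simp add: nand_def)
    then show ?thesis using False by (simp add: c'_def length_concat_blocks_le del: length_concat)
  qed
  have vars: "fst ` set (c' z) \<subseteq> block_vars n V" for z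
  proof (cases "nand n g z")
    case True then show ?thesis
      using vars_in_block[OF c(2), of "p z" "{..<n}"] p[OF True] by (simp add: c'_def block_vars_def)
  next
    case False
    have "fst ` set (in_block j (c (block z j))) \<subseteq> block_vars n V" if "j < n" for j
      using vars_in_block[OF c(2), of j "{..<n}"] that by (simp add: block_vars_def)
    then show ?thesis using False by (simp add: c'_def vars_concat_blocks del: set_concat)
  qed
  have sat: "sat z (c' z)" for z by (simp add: c'_def c(1))
  have stable: "nand n g z' = nand n g z" if s: "sat z' (c' z)" for z z'
  proof (cases "nand n g z")
    case True
    then have "\<not> g (block z' (p z))" using s c(4) p[OF True] by (auto simp: c'_def)
    then show ?thesis using True p[OF True] by (auto simp: nand_def)
  next
    case False
    then have "g (block z' j) = g (block z j)" if "j < n" for j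
      using s that by (intro c(4)) (simp add: c'_def)
    then have "g (block z' j)" if "j < n" for j using False that by (simp add: nand_def)
    then show ?thesis using False by (simp add: nand_def)
  qed
  show ?thesis by (rule certifiableI[OF sat vars len stable])
qed

text \<open>An unambiguous certificate lists the blocks up to the first one on which \<open>g\<close> fails.\<close>

lemma unambiguous_nand:
  assumes "unambiguous g V w0 w1"
  shows "unambiguous (nand n g) (block_vars n V) (n * w1) (n * w1 + w0)"
proof -
  obtain c where c: "\<And>z. sat z (c z)" "\<And>z. fst ` set (c z) \<subseteq> V"
    "\<And>z. length (c z) \<le> (if g z then w1 else w0)" "\<And>z z'. sat z' (c z) \<Longrightarrow> g z' = g z \<and> c z' = c z"
    using unambiguousE[OF assms] by blast
  \<comment> \<open>The sentinel \<open>n\<close> means that no block fails, and it guarantees that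
    a least element exists.\<close>
  define p where "p z = (LEAST j. j = n \<or> \<not> g (block z j))" for z
  have p: "p z = n \<or> \<not> g (block z (p z))" for z
    unfolding p_def by (rule LeastI[of _ n]) simp
  have pn: "p z \<le> n" for z unfolding p_def by (rule Least_le) simp
  have before: "g (block z j)" if "j < p z" for z j
    using not_less_Least[OF that[unfolded p_def]] by simp
  have nand: "nand n g z \<longleftrightarrow> p z < n" for z
  proof (cases "p z < n")
    case True then show ?thesis using p[of z] by (auto simp: nand_def)
  next
    case False
    then show ?thesis using before[of _ z] pn[of z] by (auto simp: nand_def)
  qed
  \<comment> \<open>The listed blocks are those before the first failure and the failing one itself,
    if there is one.\<close>
  define l where "l z = min n (Suc (p z))" for z
  define c' where "c' z = concat (map (\<lambda>j. in_block j (c (block z j))) [0..<l z])" for z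
  have len: "length (c' z) \<le> (if nand n g z then n * w1 + w0 else n * w1)" for z
  proof -
    have 1: "length (concat (map (\<lambda>j. in_block j (c (block z j))) [0..<p z])) \<le> p z * w1"
      using c(3) before[of _ z] by (intro length_concat_blocks_le) (metis length_in_block)
    also have "\<dots> \<le> n * w1" using pn by (rule mult_le_mono1)
    finally have 2: "length (concat (map (\<lambda>j. in_block j (c (block z j))) [0..<p z])) \<le> n * w1" .
    show ?thesis
    proof (cases "p z < n")
      case True
      then have "length (c (block z (p z))) \<le> w0" using p[of z] c(3)[of "block z (p z)"] by auto
      then show ?thesis using True 2 by (simp add: nand c'_def l_def)
    next
      case False
      then have "l z = p z" using pn[of z] by (simp add: l_def)
      then show ?thesis using False 2 by (simp add: nand c'_def)
    qed
  qed
  have vars: "fst ` set (c' z) \<subseteq> block_vars n V" for z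
  proof -
    have "fst ` set (in_block j (c (block z j))) \<subseteq> block_vars n V" if "j < n" for j
      using vars_in_block[OF c(2), of j "{..<n}"] that by (simp add: block_vars_def)
    then have "fst ` set (in_block j (c (block z j))) \<subseteq> block_vars n V" if "j < l z" for j
      using that by (simp add: l_def)
    then show ?thesis unfolding c'_def by (rule vars_concat_blocks)
  qed
  have sat: "sat z (c' z)" for z by (simp add: c'_def c(1))
  have stable: "nand n g z' = nand n g z \<and> c' z' = c' z" if s: "sat z' (c' z)" for z z'
  proof -
    have same: "g (block z' j) = g (block z j)" "c (block z' j) = c (block z j)" if "j < l z" for j
      using s c(4) that by (auto simp: c'_def)
    have "p z' = p z"
      unfolding p_def[of z']
    proof (rule Least_equality)
      show "p z = n \<or> \<not> g (block z' (p z))"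
        using p[of z] pn[of z] same(1)[of "p z"] by (auto simp: l_def)
      show "p z \<le> j" if "j = n \<or> \<not> g (block z' j)" for j
      proof (rule ccontr)
        assume "\<not> p z \<le> j"
        then have "j < p z" "j < l z" "j \<noteq> n" using pn[of z] by (auto simp: l_def)
        then show False using that same(1)[of j] before[of j z] by auto
      qed
    qed
    then have "l z' = l z" by (simp add: l_def)
    moreover have "map (\<lambda>j. in_block j (c (block z' j))) [0..<l z] = map (\<lambda>j. in_block j (c (block z j))) [0..<l z]"
      by (rule map_cong) (simp_all add: same(2))
    ultimately have "c' z' = c' z" by (simp only: c'_def)
    then show ?thesis using \<open>p z' = p z\<close> by (simp add: nand)
  qed
  show ?thesis by (rule unambiguousI[OF sat vars len stable])
qed

text \<open>Every block has its own adversary with budget \<open>q j\<close>, and the total budget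
  drops by at most one per query. The invariant is that \<open>g\<close> can still be true on every
  block; then one block with positive budget, on which \<open>g\<close> can also be false, leaves
  \<open>nand n g\<close> undetermined.\<close>

lemma hard_nand_blocks:
  assumes "\<And>z. (\<And>j. block z j \<in> Zs j) \<Longrightarrow> z \<in> Z" "\<And>j. \<exists>z\<in>Zs j. g z" "\<And>j. j < n \<Longrightarrow> hard g (q j) (Zs j)"
    and "s \<le> (\<Sum>j<n. q j)"
  shows "hard (nand n g) s Z"
  using assms
proof (induction s arbitrary: q Zs Z)
  case (Suc s)
  obtain y where y: "\<And>j. y j \<in> Zs j" "\<And>j. g (y j)" using Suc.prems(2) by metis
  have "(\<Sum>j<n. q j) \<noteq> 0" using Suc.prems(4) by linarith
  then obtain j0 where j0: "j0 < n" "q j0 \<noteq> 0" by (meson lessThan_iff sum.neutral)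
  then obtain q' where "q j0 = Suc q'" by (cases "q j0") auto
  then obtain y0 where y0: "y0 \<in> Zs j0" "g y0 = False"
    using Suc.prems(3)[OF j0(1)] hardE_value by metis
  let ?m = "\<lambda>y v. y (fst (prod_decode v)) (snd (prod_decode v)) :: bool"
  have m: "block (?m y) j = y j" for y j by (rule block_merge)
  have "?m y \<in> Z" by (rule Suc.prems(1)) (simp add: m y)
  moreover have "\<not> nand n g (?m y)" by (simp add: nand_def m y)
  moreover have "?m (y(j0 := y0)) \<in> Z" by (rule Suc.prems(1)) (simp only: m, simp add: y y0)
  moreover have "nand n g (?m (y(j0 := y0)))"
    unfolding nand_def m using j0(1) y0 by (auto intro: exI[of _ j0])
  moreover have "\<exists>b. hard (nand n g) s {z \<in> Z. z v = b}" for v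
  proof -
    obtain j i where v: "v = prod_encode (j, i)" by (metis prod_decode_inverse surj_pair)
    have gen: "hard (nand n g) s {z \<in> Z. z v = b}"
      if b: "\<exists>z\<in>{z \<in> Zs j. z i = b}. g z" and h: "j < n \<Longrightarrow> hard g r {z \<in> Zs j. z i = b}"
        and r: "j < n \<Longrightarrow> r + 1 \<ge> q j" for b r
    proof -
      define Zs' where "Zs' = Zs(j := {z \<in> Zs j. z i = b})"
      define r' where "r' = q(j := r)"
      have 1: "z \<in> {z \<in> Z. z v = b}" if "\<And>k. block z k \<in> Zs' k" for z
      proof -
        have "block z k \<in> Zs k" for k using that[of k] by (auto simp: Zs'_def split: if_splits)
        then have "z \<in> Z" by (rule Suc.prems(1))
        then show ?thesis using that[of j] by (simp add: Zs'_def v block_def)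
      qed
      have 2: "\<exists>z\<in>Zs' k. g z" for k using b Suc.prems(2) by (simp add: Zs'_def)
      have 3: "hard g (r' k) (Zs' k)" if "k < n" for k using h Suc.prems(3) that by (simp add: Zs'_def r'_def)
      have le: "s \<le> (\<Sum>k<n. r' k)"
      proof (cases "j < n")
        case True
        have "(\<Sum>k<n. q k) = q j + (\<Sum>k\<in>{..<n} - {j}. q k)" using True by (simp add: sum.remove)
        moreover have "(\<Sum>k<n. r' k) = r' j + (\<Sum>k\<in>{..<n} - {j}. r' k)" using True by (simp add: sum.remove)
        moreover have "(\<Sum>k\<in>{..<n} - {j}. r' k) = (\<Sum>k\<in>{..<n} - {j}. q k)" by (intro sum.cong) (auto simp: r'_def)
        ultimately show ?thesis using Suc.prems(4) r[OF True] by (simp add: r'_def)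
      next
        case False
        then have "(\<Sum>k<n. r' k) = (\<Sum>k<n. q k)" by (intro sum.cong) (auto simp: r'_def)
        then show ?thesis using Suc.prems(4) by simp
      qed
      show ?thesis by (rule Suc.IH[OF 1 2 3 le])
    qed
    show ?thesis
    \<comment> \<open>With budget at least 2 the adversary for \<open>g\<close> answers, and
      positive hardness remains, hence also a 1-input. The last unit is spent differently: the
      answer follows a fixed 1-input \<open>y j\<close>, since the adversary might give up the value
      true.\<close>
    proof (cases "j < n \<and> 2 \<le> q j")
      case True
      then obtain r where r: "q j = Suc (Suc r)" by (metis add_2_eq_Suc le_Suc_ex)
      then obtain b where b: "hard g (Suc r) {z \<in> Zs j. z i = b}"
        using Suc.prems(3)[of j] True unfolding r hard.simps(2)[of g "Suc r"] by blast
      then have "\<exists>z\<in>{z \<in> Zs j. z i = b}. g z" unfolding hard.simps by blast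
      then have "hard (nand n g) s {z \<in> Z. z v = b}" using b by (rule gen) (simp add: r)
      then show ?thesis by blast
    next
      case False
      have "\<exists>z\<in>{z \<in> Zs j. z i = y j i}. g z" using y[of j] by blast
      then have "hard (nand n g) s {z \<in> Z. z v = y j i}" by (rule gen[of _ 0]) (use False in auto)
      then show ?thesis by blast
    qed
  qed
  ultimately show ?case unfolding hard.simps by blast
qed simp

lemma hard_nand:
  assumes "hard g q UNIV" "0 < q"
  shows "hard (nand n g) (n * q) UNIV"
proof -
  obtain z where "g z = True" using assms hardE_value by (metis gr0_conv_Suc)
  then show ?thesis using assms by (intro hard_nand_blocks[where Zs = "\<lambda>_. UNIV" and q = "\<lambda>_. q"]) auto
qed

subsection \<open>Cheat sheets\<close>

text \<open>
  The inputs of \<open>cheat\<close> are \<open>t\<close> inputs of \<open>f\<close> in the blocks below \<open>t\<close>, and \<open>2 ^ t\<close> cells of \<open>S\<close> bits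
  in the blocks from \<open>t\<close> on. A cell encodes \<open>t\<close> lists of literals. The values of \<open>f\<close> address one cell,
  and \<open>cheat\<close> asks whether that cell holds correct certificates for these values.
\<close>

locale cheat_sheet =
  fixes f :: "(nat \<Rightarrow> bool) \<Rightarrow> bool" and V :: "nat set" and t w S :: nat
    and dec :: "bool list \<Rightarrow> cert list"
  assumes dec: "dec ` {u. length u = S} =
      {cs. length cs = t \<and> set cs \<subseteq> {c. set c \<subseteq> V \<times> UNIV \<and> length c \<le> w}}"
begin

definition address :: "(nat \<Rightarrow> bool) \<Rightarrow> nat" where
  "address z = t + set_encode {i. i < t \<and> f (block z i)}"

definition sheet :: "(nat \<Rightarrow> bool) \<Rightarrow> cert list" where
  "sheet z = dec (map (block z (address z)) [0..<S])"

definition cheat :: "(nat \<Rightarrow> bool) \<Rightarrow> bool" where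
  "cheat z \<longleftrightarrow> (\<forall>i<t. sat (block z i) (sheet z ! i) \<and> (\<forall>y. sat y (sheet z ! i) \<longrightarrow> f y = f (block z i)))"

definition cheat_vars :: "nat set" where
  "cheat_vars = prod_encode ` ({..<t} \<times> V \<union> (\<lambda>A. t + set_encode A) ` Pow {..<t} \<times> {..<S})"

definition cell_cert :: "(nat \<Rightarrow> bool) \<Rightarrow> cert" where
  "cell_cert z = map (\<lambda>r. (prod_encode (address z, r), block z (address z) r)) [0..<S]"

text \<open>The variables named on the sheet are listed with their actual values in
  \<open>z\<close>, not with the values claimed by the sheet. Hence \<open>z\<close> satisfies this
  list even if the sheet is wrong, and the list decides whether it is.\<close>

definition evidence :: "(nat \<Rightarrow> bool) \<Rightarrow> cert" where
  "evidence z = concat (map (\<lambda>i. in_block i (map (\<lambda>(v, b). (v, block z i v)) (sheet z ! i))) [0..<t])"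

lemma finite_cheat_vars: "finite V \<Longrightarrow> finite cheat_vars"
  by (simp add: cheat_vars_def)

lemma card_cheat_vars_le:
  assumes "finite V" shows "card cheat_vars \<le> t * card V + 2 ^ t * S"
proof -
  have "card cheat_vars \<le> card ({..<t} \<times> V \<union> (\<lambda>A. t + set_encode A) ` Pow {..<t} \<times> {..<S})"
    unfolding cheat_vars_def using assms by (intro card_image_le) simp
  also have "\<dots> \<le> card ({..<t} \<times> V) + card ((\<lambda>A. t + set_encode A) ` Pow {..<t} \<times> {..<S})"
    by (rule card_Un_le)
  also have "card ((\<lambda>A. t + set_encode A) ` Pow {..<t}) \<le> 2 ^ t"
    by (rule order_trans[OF card_image_le]) (simp_all add: card_Pow)
  then have "card ((\<lambda>A. t + set_encode A) ` Pow {..<t} \<times> {..<S}) \<le> 2 ^ t * S"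
    by (simp add: card_cartesian_product)
  finally show ?thesis by (simp add: card_cartesian_product)
qed

text \<open>Every cell content decodes to lists within these bounds, also a meaningless one, because
  the image of \<open>dec\<close> contains nothing else.\<close>

lemma sheet_nth:
  assumes "i < t" shows "set (sheet z ! i) \<subseteq> V \<times> UNIV" "length (sheet z ! i) \<le> w"
proof -
  have "sheet z \<in> dec ` {u. length u = S}" by (simp add: sheet_def)
  then have "length (sheet z) = t" and sub: "set (sheet z) \<subseteq> {c. set c \<subseteq> V \<times> UNIV \<and> length c \<le> w}"
    unfolding dec by auto
  then have "sheet z ! i \<in> set (sheet z)" using assms by simp
  then have "sheet z ! i \<in> {c. set c \<subseteq> V \<times> UNIV \<and> length c \<le> w}" using sub by blast
  then show "set (sheet z ! i) \<subseteq> V \<times> UNIV" "length (sheet z ! i) \<le> w" by auto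
qed

lemma length_cell_cert [simp]: "length (cell_cert z) = S"
  by (simp add: cell_cert_def)

lemma length_evidence: "length (evidence z) \<le> t * w"
  unfolding evidence_def by (rule length_concat_blocks_le) (simp add: sheet_nth)

lemma vars_cell_cert: "fst ` set (cell_cert z) \<subseteq> cheat_vars"
proof -
  have "{i. i < t \<and> f (block z i)} \<in> Pow {..<t}" by auto
  then have "address z \<in> (\<lambda>A. t + set_encode A) ` Pow {..<t}" unfolding address_def by (rule imageI)
  then show ?thesis by (auto simp: cell_cert_def cheat_vars_def)
qed

lemma vars_blocks:
  assumes "\<And>i. i < t \<Longrightarrow> fst ` set (F i) \<subseteq> V"
  shows "fst ` set (concat (map (\<lambda>i. in_block i (F i)) [0..<t])) \<subseteq> cheat_vars"
proof (rule vars_concat_blocks)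
  fix i assume i: "i < t"
  then have "fst ` set (in_block i (F i)) \<subseteq> prod_encode ` ({..<t} \<times> V)"
    using assms by (intro vars_in_block) auto
  then show "fst ` set (in_block i (F i)) \<subseteq> cheat_vars" by (auto simp: cheat_vars_def)
qed

lemma vars_evidence: "fst ` set (evidence z) \<subseteq> cheat_vars"
  unfolding evidence_def
proof (rule vars_blocks)
  fix i assume "i < t"
  then show "fst ` set (map (\<lambda>(v, b). (v, block z i v)) (sheet z ! i)) \<subseteq> V"
    using sheet_nth(1)[of i z] by auto
qed

lemma sat_cell_cert: "sat z (cell_cert z)"
  by (auto simp: sat_def cell_cert_def block_def)

lemma sat_evidence: "sat z (evidence z)"
  by (simp add: evidence_def) (auto simp: sat_def)

text \<open>The values of \<open>f\<close> give the address, the cell there gives the sheet, and the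
  evidence gives the truth of its literals. Nothing else enters \<open>cheat\<close> or the two
  lists.\<close>

lemma cheat_determined:
  assumes f: "\<And>i. i < t \<Longrightarrow> f (block z' i) = f (block z i)"
    and c: "sat z' (cell_cert z)" and e: "sat z' (evidence z)"
  shows "cheat z' = cheat z" "cell_cert z' = cell_cert z" "evidence z' = evidence z"
proof -
  have "{i. i < t \<and> f (block z' i)} = {i. i < t \<and> f (block z i)}" using f by auto
  then have a: "address z' = address z" by (simp add: address_def)
  have b: "block z' (address z) r = block z (address z) r" if "r < S" for r
    using c that by (auto simp: sat_def cell_cert_def block_def)
  then show "cell_cert z' = cell_cert z" by (simp add: cell_cert_def a)
  have "map (block z' (address z)) [0..<S] = map (block z (address z)) [0..<S]" using b by simp
  then have s: "sheet z' = sheet z" unfolding sheet_def a by (rule arg_cong)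
  have v: "block z' i v = block z i v" if "i < t" "(v, x) \<in> set (sheet z ! i)" for i v x
  proof -
    have "sat (block z' i) (map (\<lambda>(v, b). (v, block z i v)) (sheet z ! i))"
      using e that(1) by (simp add: evidence_def)
    then show ?thesis using that(2) by (fastforce simp: sat_def)
  qed
  have "in_block i (map (\<lambda>(v, b). (v, block z' i v)) (sheet z ! i)) =
      in_block i (map (\<lambda>(v, b). (v, block z i v)) (sheet z ! i))" if "i < t" for i
    using v[OF that] by (auto simp: in_block_def)
  then show "evidence z' = evidence z" unfolding evidence_def s by (intro arg_cong[where f = concat] map_cong) auto
  have "sat (block z' i) (sheet z ! i) = sat (block z i) (sheet z ! i)" if "i < t" for i
    using v[OF that] by (auto simp: sat_def)
  then show "cheat z' = cheat z" using f by (simp add: cheat_def s)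
qed

text \<open>On a correct sheet the evidence coincides with the certificates written there, so it
  fixes the values of \<open>f\<close>, and thereby the address, without further literals. This is
  what makes 1-certificates short.\<close>

lemma cheat_certified:
  assumes "cheat z" "sat z' (evidence z)" "i < t"
  shows "f (block z' i) = f (block z i)"
proof -
  have "map (\<lambda>(v, b). (v, block z i v)) (sheet z ! i) = sheet z ! i"
    using assms(1,3) unfolding cheat_def sat_def by (intro map_idI) fastforce
  moreover have "sat (block z' i) (map (\<lambda>(v, b). (v, block z i v)) (sheet z ! i))"
    using assms(2,3) by (simp add: evidence_def)
  ultimately have "sat (block z' i) (sheet z ! i)" by simp
  then show ?thesis using assms(1,3) unfolding cheat_def by blast
qed

text \<open>A 0-input must fix its address by unambiguous certificates of \<open>f\<close>; a
  1-input does so by its sheet. There unambiguity needs no unambiguous certificates of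
  \<open>f\<close>: the addressed cell is unique, and so is what is read because of it.\<close>

lemma unambiguous_cheat:
  assumes "unambiguous f V u u"
  shows "unambiguous cheat cheat_vars (t * u + (S + t * w)) (S + t * w)"
proof -
  obtain c where c: "\<And>z. sat z (c z)" "\<And>z. fst ` set (c z) \<subseteq> V"
    "\<And>z. length (c z) \<le> (if f z then u else u)" "\<And>z z'. sat z' (c z) \<Longrightarrow> f z' = f z \<and> c z' = c z"
    using unambiguousE[OF assms] by blast
  define d where "d z = concat (map (\<lambda>i. in_block i (c (block z i))) [0..<t])" for z
  define c' where "c' z = (if cheat z then [] else d z) @ cell_cert z @ evidence z" for z
  have ld: "length (d z) \<le> t * u" for z
    unfolding d_def using c(3) by (intro length_concat_blocks_le) simp
  have "length (c' z) \<le> (if cheat z then S + t * w else t * u + (S + t * w))" for z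
    using ld[of z] length_evidence[of z] by (simp add: c'_def)
  moreover have "fst ` set (d z) \<subseteq> cheat_vars" for z
    unfolding d_def by (rule vars_blocks) (rule c(2))
  then have "fst ` set (c' z) \<subseteq> cheat_vars" for z
    using vars_cell_cert[of z] vars_evidence[of z] unfolding c'_def by (simp add: image_Un)
  moreover have "sat z (c' z)" for z
    by (simp add: c'_def d_def sat_cell_cert sat_evidence c(1))
  moreover have "cheat z' = cheat z \<and> c' z' = c' z" if s: "sat z' (c' z)" for z z'
  proof -
    have *: "sat z' (cell_cert z)" "sat z' (evidence z)" using s by (simp_all add: c'_def)
    have dz: "c (block z' i) = c (block z i) \<and> f (block z' i) = f (block z i)" if "\<not> cheat z" "i < t" for i
      using s that c(4)[of "block z' i" "block z i"] by (simp add: c'_def d_def)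
    have f: "f (block z' i) = f (block z i)" if "i < t" for i
      using that dz cheat_certified[OF _ *(2)] by blast
    have "d z' = d z" if "\<not> cheat z"
      unfolding d_def using dz[OF that] by (intro arg_cong[where f = concat] map_cong) auto
    then show ?thesis using cheat_determined[OF f *] by (simp add: c'_def)
  qed
  ultimately show ?thesis by (intro unambiguousI[of c']) blast+
qed

lemma certifiable_cheat:
  assumes "certifiable f V w w"
  shows "certifiable cheat cheat_vars (t * w + (S + t * w)) (S + t * w)"
proof -
  obtain c where c: "\<And>z. sat z (c z)" "\<And>z. fst ` set (c z) \<subseteq> V"
    "\<And>z. length (c z) \<le> (if f z then w else w)" "\<And>z z'. sat z' (c z) \<Longrightarrow> f z' = f z"
    using certifiableE[OF assms] by blast
  define d where "d z = concat (map (\<lambda>i. in_block i (c (block z i))) [0..<t])" for z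
  define c' where "c' z = (if cheat z then [] else d z) @ cell_cert z @ evidence z" for z
  have ld: "length (d z) \<le> t * w" for z
    unfolding d_def using c(3) by (intro length_concat_blocks_le) simp
  have "length (c' z) \<le> (if cheat z then S + t * w else t * w + (S + t * w))" for z
    using ld[of z] length_evidence[of z] by (simp add: c'_def)
  moreover have "fst ` set (d z) \<subseteq> cheat_vars" for z
    unfolding d_def by (rule vars_blocks) (rule c(2))
  then have "fst ` set (c' z) \<subseteq> cheat_vars" for z
    using vars_cell_cert[of z] vars_evidence[of z] unfolding c'_def by (simp add: image_Un)
  moreover have "sat z (c' z)" for z
    by (simp add: c'_def d_def sat_cell_cert sat_evidence c(1))
  moreover have "cheat z' = cheat z" if s: "sat z' (c' z)" for z z'
  proof -
    have *: "sat z' (cell_cert z)" "sat z' (evidence z)" using s by (simp_all add: c'_def)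
    have "f (block z' i) = f (block z i)" if "\<not> cheat z" "i < t" for i
      using s that c(4)[of "block z' i" "block z i"] by (simp add: c'_def d_def)
    then have f: "f (block z' i) = f (block z i)" if "i < t" for i
      using that cheat_certified[OF _ *(2)] by blast
    show ?thesis using cheat_determined[OF f *] by simp
  qed
  ultimately show ?thesis by (intro certifiableI[of c']) blast+
qed

text \<open>As long as some cell is untouched and \<open>f\<close> is undetermined on every block, the adversary can
  make that cell the addressed one and fill it with right or wrong certificates.\<close>

lemma hard_cheat_blocks:
  assumes cert: "certifiable f V w w" and t: "0 < t"
    and "\<And>z. (\<And>j. block z j \<in> Zs j) \<Longrightarrow> z \<in> Z" "\<And>j. Zs j \<noteq> {}" "\<And>i. i < t \<Longrightarrow> hard f q (Zs i)"
    and "q \<le> card {A \<in> Pow {..<t}. Zs (t + set_encode A) = UNIV}"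
  shows "hard cheat q Z"
  using assms(3-)
proof (induction q arbitrary: Zs Z)
  case (Suc q)
  have "{A \<in> Pow {..<t}. Zs (t + set_encode A) = UNIV} \<noteq> {}"
  proof
    assume e: "{A \<in> Pow {..<t}. Zs (t + set_encode A) = UNIV} = {}"
    show False using Suc.prems(4) unfolding e by simp
  qed
  then obtain A where A: "A \<subseteq> {..<t}" "Zs (t + set_encode A) = UNIV" by blast
  \<comment> \<open>The blocks below \<open>t\<close> get the values of \<open>f\<close> that
    address the untouched cell \<open>A\<close>; the other blocks get any element.\<close>
  have "\<exists>y\<in>Zs j. j < t \<longrightarrow> f y = (j \<in> A)" for j
    using Suc.prems(2)[of j] hardE_value[OF Suc.prems(3), of j "j \<in> A"] by (cases "j < t") blast+
  then obtain y where y: "\<And>j. y j \<in> Zs j" "\<And>j. j < t \<Longrightarrow> f (y j) = (j \<in> A)" by metis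
  have fill: "\<exists>z\<in>Z. sheet z = cs \<and> (\<forall>i<t. block z i = y i)"
    if cs: "length cs = t" "set cs \<subseteq> {c. set c \<subseteq> V \<times> UNIV \<and> length c \<le> w}" for cs
  proof -
    have "cs \<in> dec ` {u. length u = S}" unfolding dec using cs by simp
    then obtain u where u: "length u = S" "dec u = cs" by auto
    define y' where "y' = y(t + set_encode A := (\<lambda>r. u ! r))"
    define z where "z v = y' (fst (prod_decode v)) (snd (prod_decode v))" for v
    have bz: "block z j = y' j" for j unfolding z_def by (rule block_merge)
    have "z \<in> Z"
      by (rule Suc.prems(1)) (use A(2) y(1) in \<open>auto simp: bz y'_def\<close>)
    moreover have bi: "block z i = y i" if "i < t" for i using that by (simp add: bz y'_def)
    moreover have "{i. i < t \<and> f (block z i)} = A" using A(1) y(2) bi by auto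
    then have "block z (address z) = (!) u" by (simp add: address_def bz y'_def)
    then have "map (block z (address z)) [0..<S] = u" using u(1) map_nth[of u] by simp
    then have "sheet z = cs" by (simp add: sheet_def u(2))
    ultimately show ?thesis by blast
  qed
  have "\<exists>z\<in>Z. cheat z"
  proof -
    obtain c where c: "\<And>z. sat z (c z)" "\<And>z. fst ` set (c z) \<subseteq> V"
      "\<And>z. length (c z) \<le> (if f z then w else w)" "\<And>z z'. sat z' (c z) \<Longrightarrow> f z' = f z"
      using certifiableE[OF cert] by blast
    have "set (c z) \<subseteq> V \<times> UNIV" "length (c z) \<le> w" for z using c(2,3)[of z] by force+
    then obtain z where z: "z \<in> Z" "sheet z = map (\<lambda>i. c (y i)) [0..<t]" "\<forall>i<t. block z i = y i"
      using fill[of "map (\<lambda>i. c (y i)) [0..<t]"] by auto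
    then have "cheat z" using c(1,4) by (simp add: cheat_def)
    then show ?thesis using z(1) by blast
  qed
  moreover have "\<exists>z\<in>Z. \<not> cheat z"
  proof -
    \<comment> \<open>Empty lists are wrong certificates: every input satisfies them, but
      \<open>f\<close> is not constant.\<close>
    have "set (replicate t []) \<subseteq> {c. set c \<subseteq> V \<times> UNIV \<and> length c \<le> w}" by auto
    then obtain z where z: "z \<in> Z" "sheet z = replicate t []"
      using fill[of "replicate t []"] unfolding length_replicate by blast
    obtain y1 where "f y1 \<noteq> f (block z 0)"
      using hardE_value[OF Suc.prems(3)[OF t], of "\<not> f (block z 0)"] by metis
    then have "\<not> cheat z" using t z(2) by (auto simp: cheat_def sat_def intro!: exI[of _ 0])
    then show ?thesis using z(1) by blast
  qed
  moreover have "\<exists>b. hard cheat q {z \<in> Z. z v = b}" for v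
  \<comment> \<open>Positive \<open>q\<close> is needed to conclude from \<open>hard f q\<close>
    that the restricted set is nonempty; for \<open>q = 0\<close> the goal is trivial.\<close>
  proof (cases q)
    case (Suc q')
    obtain j i where v: "v = prod_encode (j, i)" by (metis prod_decode_inverse surj_pair)
    have "\<exists>b. {z \<in> Zs j. z i = b} \<noteq> {} \<and> (j < t \<longrightarrow> hard f q {z \<in> Zs j. z i = b})"
    proof (cases "j < t")
      case True
      then obtain b where b: "hard f q {z \<in> Zs j. z i = b}"
        using Suc.prems(3) unfolding hard.simps(2)[of f q] by blast
      then have "{z \<in> Zs j. z i = b} \<noteq> {}" unfolding Suc hard.simps by blast
      then show ?thesis using b by blast
    next
      case False
      obtain y where "y \<in> Zs j" using Suc.prems(2) by blast
      then have "{z \<in> Zs j. z i = y i} \<noteq> {}" by blast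
      then show ?thesis using False by blast
    qed
    then obtain b where b: "{z \<in> Zs j. z i = b} \<noteq> {}" "j < t \<Longrightarrow> hard f q {z \<in> Zs j. z i = b}" by blast
    define Zs' where "Zs' = Zs(j := {z \<in> Zs j. z i = b})"
    have 1: "z \<in> {z \<in> Z. z v = b}" if "\<And>k. block z k \<in> Zs' k" for z
    proof -
      have "block z k \<in> Zs k" for k using that[of k] by (auto simp: Zs'_def split: if_splits)
      then have "z \<in> Z" by (rule Suc.prems(1))
      then show ?thesis using that[of j] by (simp add: Zs'_def v block_def)
    qed
    have 2: "Zs' k \<noteq> {}" for k using b(1) Suc.prems(2) by (simp add: Zs'_def)
    have 3: "hard f q (Zs' k)" if "k < t" for k
      using b(2) that hard_SucD[OF Suc.prems(3)] by (simp add: Zs'_def)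
    let ?U = "\<lambda>Zs. {A \<in> Pow {..<t}. Zs (t + set_encode A) = UNIV}"
    have fin: "finite (?U Zs')" by simp
    have 4: "q \<le> card (?U Zs')"
    proof -
      have inj: "A = B" if "A \<subseteq> {..<t}" "B \<subseteq> {..<t}" "set_encode A = set_encode B" for A B
        using that inj_on_set_encode finite_subset by (metis (no_types, lifting) finite_lessThan inj_onD mem_Collect_eq)
      \<comment> \<open>A query touches at most one cell. \<open>B\<close> is the set that addresses
        it, or the dummy \<open>{}\<close> if no cell is touched.\<close>
      obtain B where "?U Zs \<subseteq> insert B (?U Zs')"
      proof (cases "\<exists>B\<in>Pow {..<t}. t + set_encode B = j")
        case True
        then obtain B where B: "B \<subseteq> {..<t}" "t + set_encode B = j" by blast
        then have "A = B" if "A \<subseteq> {..<t}" "t + set_encode A = j" for A using inj[OF that(1) B(1)] that by simp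
        then have "?U Zs \<subseteq> insert B (?U Zs')" by (auto simp: Zs'_def)
        then show thesis by (rule that)
      next
        case False
        then have "?U Zs \<subseteq> insert {} (?U Zs')" by (auto simp: Zs'_def)
        then show thesis by (rule that)
      qed
      then have "card (?U Zs) \<le> Suc (card (?U Zs'))"
        using fin card_mono[of "insert B (?U Zs')" "?U Zs"] by (simp add: card_insert_if split: if_splits)
      then show ?thesis using Suc.prems(4) by linarith
    qed
    have "hard cheat q {z \<in> Z. z v = b}" by (rule Suc.IH[OF 1 2 3 4])
    then show ?thesis by blast
  qed simp
  ultimately show ?case unfolding hard.simps by blast
qed simp

lemma hard_cheat:
  assumes "certifiable f V w w" "0 < t" "hard f q UNIV" "q \<le> 2 ^ t"
  shows "hard cheat q UNIV"
proof (rule hard_cheat_blocks[OF assms(1,2), where Zs = "\<lambda>_. UNIV"])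
  show "q \<le> card {A \<in> Pow {..<t}. (UNIV :: (nat \<Rightarrow> bool) set) = UNIV}"
    using assms(4) card_Pow[of "{..<t}"] by (simp add: Pow_def)
qed (use assms(3) in auto)

end

section \<open>Coding certificates in cells\<close>

lemma card_lists_length_le_power:
  assumes "finite A" shows "card {xs. set xs \<subseteq> A \<and> length xs \<le> n} \<le> (card A + 1) ^ n"
proof -
  have "(\<Sum>i\<le>n. card A ^ i) \<le> (card A + 1) ^ n"
  proof (induction n)
    case (Suc n)
    have step: "card A ^ Suc n \<le> card A * (card A + 1) ^ n" by (simp add: power_mono)
    have "(\<Sum>i\<le>Suc n. card A ^ i) = (\<Sum>i\<le>n. card A ^ i) + card A ^ Suc n" by simp
    also have "\<dots> \<le> (card A + 1) ^ n + card A * (card A + 1) ^ n" by (rule add_mono[OF Suc step])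
    also have "\<dots> = (card A + 1) ^ Suc n" by simp
    finally show ?case .
  qed simp
  then show ?thesis by (simp add: card_lists_length_le assms)
qed

lemma exists_surj_card_le:
  assumes "finite A" "finite B" "B \<noteq> {}" "card B \<le> card A"
  shows "\<exists>g. g ` A = B"
proof -
  obtain h where h: "h ` B \<subseteq> A" "inj_on h B" using card_le_inj[OF assms(2,1,4)] by blast
  obtain b where b: "b \<in> B" using assms(3) by blast
  let ?g = "\<lambda>a. if a \<in> h ` B then inv_into B h a else b"
  have "?g ` A = B"
  proof
    show "?g ` A \<subseteq> B" using b by (auto intro: inv_into_into)
    show "B \<subseteq> ?g ` A"
    proof
      fix x assume "x \<in> B"
      then have "x = ?g (h x)" "h x \<in> A" using h by auto
      then show "x \<in> ?g ` A" by (rule image_eqI)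
    qed
  qed
  then show ?thesis by blast
qed

text \<open>\<open>L\<close> bits suffice for one literal or a padding symbol, so
  \<open>t * w * L\<close> bits provide at least as many cell contents as there are sheets, and a
  surjective decoding exists by counting.\<close>

lemma exists_cheat_sheet:
  assumes V: "finite V" "2 * card V + 1 \<le> 2 ^ L" and t: "0 < t" "q \<le> 2 ^ t"
    and f: "certifiable f V w w" "unambiguous f V u u" "hard f q UNIV"
  shows "\<exists>f' V'. finite V' \<and> card V' \<le> t * card V + 2 ^ t * (t * w * L) \<and> hard f' q UNIV \<and>
    certifiable f' V' (t * w * (L + 2)) (t * w * (L + 2)) \<and>
    unambiguous f' V' (t * u + t * w * (L + 1)) (t * w * (L + 1))"
proof -
  let ?S = "t * w * L"
  let ?W = "{c. set c \<subseteq> V \<times> (UNIV :: bool set) \<and> length c \<le> w}"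
  let ?B = "{cs. length cs = t \<and> set cs \<subseteq> ?W}"
  have finW: "finite ?W" using V by (intro finite_lists_length_le) simp
  have "card ?W \<le> (card (V \<times> (UNIV :: bool set)) + 1) ^ w"
    using V by (intro card_lists_length_le_power) simp
  also have "\<dots> \<le> (2 ^ L) ^ w" using V by (intro power_mono) (simp_all add: card_cartesian_product)
  finally have "card ?W \<le> 2 ^ (L * w)" by (simp add: power_mult)
  then have "card ?W ^ t \<le> (2 ^ (L * w)) ^ t" by (rule power_mono) simp
  also have "(2 ^ (L * w)) ^ t = (2 :: nat) ^ ?S" by (simp add: power_mult[symmetric] ac_simps)
  finally have "card ?W ^ t \<le> 2 ^ ?S" .
  moreover have "?B = {cs. set cs \<subseteq> ?W \<and> length cs = t}" by auto
  ultimately have "card ?B \<le> 2 ^ ?S" and finB: "finite ?B"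
    using card_lists_length_eq[OF finW, of t] finite_lists_length_eq[OF finW, of t]
    by (simp_all only:)
  moreover have "{u :: bool list. length u = ?S} = {u. set u \<subseteq> UNIV \<and> length u = ?S}" by simp
  then have "card {u :: bool list. length u = ?S} = 2 ^ ?S" "finite {u :: bool list. length u = ?S}"
    using card_lists_length_eq[of "UNIV :: bool set" ?S] finite_lists_length_eq[of "UNIV :: bool set" ?S]
    by simp_all
  moreover have "replicate t [] \<in> ?B" by auto
  then have "?B \<noteq> {}" by blast
  ultimately obtain dec :: "bool list \<Rightarrow> cert list" where dec: "dec ` {u. length u = ?S} = ?B"
    using exists_surj_card_le[of "{u :: bool list. length u = ?S}" ?B] by auto
  interpret cheat_sheet f V t w ?S dec by unfold_locales (rule dec)
  have "certifiable cheat cheat_vars (t * w * (L + 2)) (t * w * (L + 2))"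
    by (rule certifiable_mono[OF certifiable_cheat[OF f(1)]]) (simp_all add: algebra_simps)
  moreover have "unambiguous cheat cheat_vars (t * u + t * w * (L + 1)) (t * w * (L + 1))"
    by (rule unambiguous_mono[OF unambiguous_cheat[OF f(2)]]) (simp_all add: algebra_simps)
  ultimately show ?thesis
    using finite_cheat_vars[OF V(1)] card_cheat_vars_le[OF V(1)] hard_cheat[OF f(1) t(1) f(3) t(2)] by blast
qed

section \<open>Degrees and projections\<close>

definition proj :: "nat set \<Rightarrow> (nat \<Rightarrow> 'a) set \<Rightarrow> (nat \<Rightarrow> 'a) set" where
  "proj I A = (\<lambda>x. restrict x I) ` A"

definition fiber :: "(nat \<Rightarrow> 'a) set \<Rightarrow> nat \<Rightarrow> (nat \<Rightarrow> 'a) \<Rightarrow> 'a set" where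
  "fiber A i x = {a. x(i := a) \<in> A}"

text \<open>For each \<open>i\<close>, view \<open>A\<close> as a bipartite graph between its
  projection to the other coordinates and the values of coordinate \<open>i\<close>. This bounds the
  minimum degree on the first side.\<close>

definition thick :: "nat \<Rightarrow> nat set \<Rightarrow> (nat \<Rightarrow> 'a) set \<Rightarrow> bool" where
  "thick \<tau> I A \<longleftrightarrow> (\<forall>x\<in>A. \<forall>i\<in>I. \<tau> \<le> card (fiber A i x))"

lemma finite_proj: "finite A \<Longrightarrow> finite (proj I A)"
  by (simp add: proj_def)

lemma proj_mono: "A \<subseteq> B \<Longrightarrow> proj I A \<subseteq> proj I B"
  by (auto simp: proj_def)

lemma proj_proj: "J \<subseteq> I \<Longrightarrow> proj J (proj I A) = proj J A"
  by (auto simp: proj_def image_image inf.absorb2)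

lemma proj_empty_iff [simp]: "proj I A = {} \<longleftrightarrow> A = {}"
  by (simp add: proj_def)

lemma proj_subset_extensional: "proj I A \<subseteq> extensional I"
  by (auto simp: proj_def)

lemma proj_subset_PiE: "A \<subseteq> PiE V D \<Longrightarrow> I \<subseteq> V \<Longrightarrow> proj I A \<subseteq> PiE I D"
  by (fastforce simp: proj_def)

lemma proj_self: "A \<subseteq> extensional I \<Longrightarrow> proj I A = A"
  unfolding proj_def by (force simp: extensional_restrict)

lemma restrict_upd_same: "x \<in> extensional I \<Longrightarrow> i \<in> I \<Longrightarrow> (restrict x (I - {i}))(i := a) = x(i := a)"
  by (auto simp: fun_eq_iff extensional_def)

section \<open>Fibers and pruning to large minimum degree\<close>

lemma finite_fiber:
  assumes "finite A" shows "finite (fiber A i x)"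
proof -
  have "(\<lambda>a. x(i := a)) ` fiber A i x \<subseteq> A" by (auto simp: fiber_def)
  moreover have "inj_on (\<lambda>a. x(i := a)) (fiber A i x)" by (auto simp: inj_on_def dest: fun_upd_eqD)
  ultimately show ?thesis using assms by (meson finite_imageD finite_subset)
qed

lemma card_eq_sum_fiber:
  assumes "finite A" "A \<subseteq> extensional I" "i \<in> I"
  shows "card A = (\<Sum>w\<in>proj (I - {i}) A. card (fiber A i w))"
proof -
  let ?S = "SIGMA w : proj (I - {i}) A. fiber A i w"
  have "bij_betw (\<lambda>(w, a). w(i := a)) ?S A"
    unfolding bij_betw_def
  proof
    show "inj_on (\<lambda>(w, a). w(i := a)) ?S"
    proof (rule inj_onI, clarify)
      fix w a w' a'
      assume w: "w \<in> proj (I - {i}) A" "w' \<in> proj (I - {i}) A" and e: "w(i := a) = w'(i := a')"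
      have "w i = undefined" "w' i = undefined" using w by (auto simp: proj_def)
      then have "w j = w' j" for j
        by (metis e fun_upd_apply)
      then show "w = w' \<and> a = a'" using e by (metis fun_upd_same ext)
    qed
    show "(\<lambda>(w, a). w(i := a)) ` ?S = A"
    proof
      show "A \<subseteq> (\<lambda>(w, a). w(i := a)) ` ?S"
      proof
        fix x assume x: "x \<in> A"
        have "(restrict x (I - {i}))(i := x i) = x"
          using x assms by (subst restrict_upd_same) auto
        then have "(restrict x (I - {i}), x i) \<in> ?S" "x = (\<lambda>(w, a). w(i := a)) (restrict x (I - {i}), x i)"
          using x by (auto simp: proj_def fiber_def)
        then show "x \<in> (\<lambda>(w, a). w(i := a)) ` ?S" by blast
      qed
    qed (auto simp: fiber_def)
  qed
  then have "card A = card ?S" by (simp add: bij_betw_same_card)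
  also have "\<dots> = (\<Sum>w\<in>proj (I - {i}) A. card (fiber A i w))"
    using assms by (intro card_SigmaI) (auto simp: finite_proj finite_fiber)
  finally show ?thesis .
qed

text \<open>Fibers with fewer than \<open>\<tau>\<close> points are deleted one after the other.
  Each deletion loses less than \<open>\<tau>\<close> points but also a point of one projection, so
  \<open>card A\<close> minus \<open>\<tau>\<close> times the total size of the projections never
  decreases.\<close>

lemma thick_subset_potential:
  assumes "finite I" "finite A" "A \<subseteq> extensional I"
  shows "\<exists>A'\<subseteq>A. thick \<tau> I A' \<and>
    card A + \<tau> * (\<Sum>i\<in>I. card (proj (I - {i}) A')) \<le> card A' + \<tau> * (\<Sum>i\<in>I. card (proj (I - {i}) A))"
  using assms(2,3)
proof (induction "card A" arbitrary: A rule: less_induct)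
  case less
  show ?case
  proof (cases "thick \<tau> I A")
    case True then show ?thesis by auto
  next
    case False
    then obtain x i where x: "x \<in> A" and i: "i \<in> I" and c: "card (fiber A i x) < \<tau>"
      by (auto simp: thick_def not_le)
    define R where "R = (\<lambda>a. x(i := a)) ` fiber A i x"
    define A1 where "A1 = A - R"
    have RA: "R \<subseteq> A" by (auto simp: R_def fiber_def)
    have finR: "finite R" using RA less.prems finite_subset by blast
    have "card R < \<tau>"
      using c card_image_le[OF finite_fiber[OF less.prems(1)], of "\<lambda>a. x(i:=a)" i x] by (simp add: R_def)
    then have cA1: "card A \<le> card A1 + \<tau>"
      using card_Diff_subset[OF finR RA] by (simp add: A1_def)
    have xR: "x \<in> R" unfolding R_def fiber_def using x by (auto intro!: image_eqI[of _ _ "x i"])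
    then have sub: "A1 \<subset> A" using x by (auto simp: A1_def)
    then have lt: "card A1 < card A" using less.prems(1) psubset_card_mono by blast
    have fin1: "finite A1" and ext1: "A1 \<subseteq> extensional I" using less.prems A1_def by auto
    obtain A' where A': "A' \<subseteq> A1" "thick \<tau> I A'"
      "card A1 + \<tau> * (\<Sum>i\<in>I. card (proj (I - {i}) A')) \<le> card A' + \<tau> * (\<Sum>i\<in>I. card (proj (I - {i}) A1))"
      using less.hyps[OF lt fin1 ext1] by blast
    \<comment> \<open>The whole line through \<open>x\<close> in direction \<open>i\<close> was
      deleted, so no point above this projection survives.\<close>
    have notin: "restrict x (I - {i}) \<notin> proj (I - {i}) A1"
    proof
      assume "restrict x (I - {i}) \<in> proj (I - {i}) A1"
      then obtain x' where x': "x' \<in> A1" "restrict x (I - {i}) = restrict x' (I - {i})"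
        by (auto simp: proj_def)
      have "x(i := x' i) = x'(i := x' i)"
        using x' x i less.prems ext1 by (metis restrict_upd_same subsetD)
      then have "x' = x(i := x' i)" by simp
      moreover from this have "x' i \<in> fiber A i x" using x' sub by (auto simp: fiber_def)
      ultimately have "x' \<in> R" unfolding R_def by blast
      then show False using x' by (simp add: A1_def)
    qed
    have "proj (I - {i}) A1 \<subset> proj (I - {i}) A"
      using notin proj_mono[of A1 A "I - {i}"] sub x by (auto simp: proj_def)
    then have "card (proj (I - {i}) A1) < card (proj (I - {i}) A)"
      by (intro psubset_card_mono finite_proj less.prems)
    moreover have "card (proj (I - {j}) A1) \<le> card (proj (I - {j}) A)" for j
      using sub less.prems by (intro card_mono finite_proj proj_mono) auto
    ultimately have "(\<Sum>i\<in>I. card (proj (I - {i}) A1)) < (\<Sum>i\<in>I. card (proj (I - {i}) A))"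
      using i assms(1) by (intro sum_strict_mono_ex1) auto
    then have "\<tau> * (\<Sum>i\<in>I. card (proj (I - {i}) A1)) + \<tau> \<le> \<tau> * (\<Sum>i\<in>I. card (proj (I - {i}) A))"
      by (metis Suc_leI mult_Suc_right mult_le_mono2 add.commute)
    then show ?thesis using A' cA1 sub by (intro exI[of _ A']) auto
  qed
qed

text \<open>Average degree at least \<open>m / 8\<close> in each direction bounds the total size of
  the projections by \<open>8 * card I * card A / m\<close>. Times \<open>\<tau>\<close> this is at
  most half of \<open>card A\<close>, which bounds the loss in the potential argument.\<close>

lemma thick_subset_half:
  assumes "finite I" "finite A" "A \<subseteq> extensional I"
    and avg: "\<And>i. i \<in> I \<Longrightarrow> m * card (proj (I - {i}) A) \<le> 8 * card A"
    and \<tau>: "16 * \<tau> * card I \<le> m" "0 < m"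
  shows "\<exists>A'\<subseteq>A. thick \<tau> I A' \<and> card A \<le> 2 * card A'"
proof -
  obtain A' where A': "A' \<subseteq> A" "thick \<tau> I A'"
    "card A + \<tau> * (\<Sum>i\<in>I. card (proj (I - {i}) A')) \<le> card A' + \<tau> * (\<Sum>i\<in>I. card (proj (I - {i}) A))"
    using thick_subset_potential[OF assms(1-3), of \<tau>] by blast
  have "m * (\<Sum>i\<in>I. card (proj (I - {i}) A)) \<le> card I * (8 * card A)"
    unfolding sum_distrib_left using avg by (intro sum_bounded_above[THEN order_trans]) auto
  then have "2 * \<tau> * (m * (\<Sum>i\<in>I. card (proj (I - {i}) A))) \<le> 2 * \<tau> * (card I * (8 * card A))"
    by (rule mult_le_mono2)
  also have "\<dots> \<le> m * card A" using mult_le_mono1[OF \<tau>(1), of "card A"] by (simp add: ac_simps)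
  finally have "2 * \<tau> * (\<Sum>i\<in>I. card (proj (I - {i}) A)) \<le> card A"
    using \<tau>(2) by (metis (no_types, lifting) mult.left_commute mult_le_cancel1)
  then have "card A \<le> 2 * card A'" using A'(3) by linarith
  then show ?thesis using A' by blast
qed

lemma thick_proj:
  assumes "thick \<tau> I A" "J \<subseteq> I" "finite A"
  shows "thick \<tau> J (proj J A)"
  unfolding thick_def
proof (intro ballI)
  fix w i assume "w \<in> proj J A" "i \<in> J"
  then obtain x where x: "x \<in> A" "w = restrict x J" by (auto simp: proj_def)
  have "restrict (x(i := a)) J = w(i := a)" for a using x(2) \<open>i \<in> J\<close> by (auto simp: fun_eq_iff)
  then have "fiber A i x \<subseteq> fiber (proj J A) i w"
    unfolding fiber_def proj_def by (metis (mono_tags, lifting) Collect_mono image_eqI)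
  then have "card (fiber A i x) \<le> card (fiber (proj J A) i w)"
    by (intro card_mono finite_fiber finite_proj assms)
  then show "\<tau> \<le> card (fiber (proj J A) i w)"
    using assms x \<open>i \<in> J\<close> unfolding thick_def by (meson order_trans subsetD)
qed

text \<open>The threshold of order \<open>1 / K\<close> instead of a constant costs only logarithmic factors later
  and lets a union bound replace an entropy estimate.\<close>

lemma few_unbalanced_coordinates:
  assumes S: "S \<subseteq> Pow {..<m}" and big: "2 ^ m \<le> card S * 2 ^ K" and c: "2 * (K + 2) \<le> c"
  shows "card {a. a < m \<and> c * card {s \<in> S. (a \<in> s) = b} < card S} \<le> K + 1"
proof (rule ccontr)
  let ?T = "{a. a < m \<and> c * card {s \<in> S. (a \<in> s) = b} < card S}"
  assume "\<not> ?thesis"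
  then have "K + 2 \<le> card ?T" by linarith
  \<comment> \<open>Deleting all sets with the rare value \<open>b\<close> somewhere on
    \<open>T\<close> leaves at least half of \<open>S\<close>. The survivors are frozen on
    \<open>T\<close>, hence number at most \<open>2 ^ (m - (K + 2))\<close>, too few for the density
    of \<open>S\<close>.\<close>
  then obtain T where T: "T \<subseteq> ?T" "card T = K + 2" by (meson obtain_subset_with_card_n)
  have finT: "finite T" using T(2) by (intro card_ge_0_finite) simp
  have finS: "finite S" using S finite_subset by blast
  let ?U = "\<Union>a\<in>T. {s \<in> S. (a \<in> s) = b}"
  let ?R = "S - ?U"
  have "card ?U \<le> (\<Sum>a\<in>T. card {s \<in> S. (a \<in> s) = b})" by (rule card_UN_le[OF finT])
  then have "c * card ?U \<le> (\<Sum>a\<in>T. c * card {s \<in> S. (a \<in> s) = b})"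
    unfolding sum_distrib_left[symmetric] by (rule mult_le_mono2)
  also have "\<dots> \<le> (\<Sum>a\<in>T. card S)" using T(1) by (intro sum_mono) auto
  also have "\<dots> = (K + 2) * card S" using T by simp
  finally have "2 * (K + 2) * card ?U \<le> (K + 2) * card S"
    using mult_le_mono1[OF c, of "card ?U"] by linarith
  then have "(K + 2) * (2 * card ?U) \<le> (K + 2) * card S" by (simp only: ac_simps)
  then have "2 * card ?U \<le> card S" by (subst (asm) mult_le_cancel1) simp
  moreover have "card S = card ?U + card ?R"
  proof -
    have "?U \<subseteq> S" by auto
    then show ?thesis using finS card_Diff_subset[of ?U S] card_mono[of S ?U] finite_subset[of ?U S] by simp
  qed
  ultimately have half: "card S \<le> 2 * card ?R" by linarith
  let ?E = "(if b then {} else T)"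
  have "?R \<subseteq> (\<lambda>s. s \<union> ?E) ` Pow ({..<m} - T)"
  proof
    fix s assume s: "s \<in> ?R"
    have "s \<inter> T = ?E" using s T by auto
    then have "s = (s - T) \<union> ?E" by auto
    moreover have "s - T \<in> Pow ({..<m} - T)" using s S by auto
    ultimately show "s \<in> (\<lambda>s. s \<union> ?E) ` Pow ({..<m} - T)" by blast
  qed
  then have "card ?R \<le> card (Pow ({..<m} - T))"
    by (meson card_image_le card_mono finite_Diff finite_Pow_iff finite_imageI finite_lessThan le_trans)
  also have "\<dots> = 2 ^ (m - (K + 2))"
    using T finT by (subst card_Pow) (auto simp: card_Diff_subset subset_iff)
  finally have R: "card ?R \<le> 2 ^ (m - (K + 2))" .
  have "K + 2 \<le> m" using T card_mono[of "{..<m}" T] by (auto simp: subset_iff)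
  then have e: "(2::nat) ^ m = 2 ^ (m - (K + 2)) * 2 ^ (K + 2)"
    by (metis le_add_diff_inverse2 power_add)
  have "2 ^ (m - (K + 2)) * 2 ^ (K + 2) \<le> 2 * card ?R * 2 ^ K"
    using big half e mult_le_mono1[OF half, of "2^K"] by linarith
  also have "\<dots> \<le> 2 * 2 ^ (m - (K + 2)) * 2 ^ K" using R by simp
  finally show False by simp
qed

text \<open>The list is treated entry by entry. Unless the next entry is one of at most
  \<open>K + 1\<close> unbalanced coordinates, forcing its membership to \<open>b\<close> costs
  \<open>S\<close> only a factor \<open>c\<close>; the factor \<open>c ^ r\<close> in the hypothesis
  pays for \<open>r\<close> such steps. So each position contributes a fraction
  \<open>(K + 1) / m\<close> of failing lists.\<close>

lemma few_missing_lists: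
  assumes "S \<subseteq> Pow {..<m}" "2 ^ m * c ^ r \<le> card S * 2 ^ K" "2 * (K + 2) \<le> c"
  shows "m * card {u. length u = r \<and> set u \<subseteq> {..<m} \<and> \<not> (\<exists>s\<in>S. \<forall>a\<in>set u. (a \<in> s) = b)}
    \<le> r * (K + 1) * m ^ r"
  using assms(1,2)
proof (induction r arbitrary: S)
  case 0
  have "S \<noteq> {}" using 0 by (intro notI) simp
  then show ?case by (auto simp: ex_in_conv)
next
  case (Suc r)
  define B where "B r S = {u. length u = r \<and> set u \<subseteq> {..<m} \<and> \<not> (\<exists>s\<in>S. \<forall>a\<in>set u. (a \<in> s) = b)}" for r S
  define T where "T = {a. a < m \<and> c * card {s \<in> S. (a \<in> s) = b} < card S}"
  define L where "L = {u. length u = r \<and> set u \<subseteq> {..<m}}"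
  let ?S = "\<lambda>a. {s \<in> S. (a \<in> s) = b}"
  have c0: "c > 0" using assms(3) by simp
  have "2 ^ m * 1 \<le> 2 ^ m * c ^ Suc r" using c0 by (intro mult_le_mono2) (simp add: Suc_le_eq)
  then have T: "card T \<le> K + 1" unfolding T_def
    using Suc.prems by (intro few_unbalanced_coordinates assms) linarith+
  have finT: "finite T" by (rule finite_subset[of _ "{..<m}"]) (auto simp: T_def)
  have finB: "finite (B r S)" for r S
    by (rule finite_subset[OF _ finite_lists_length_eq[of "{..<m}" r]]) (auto simp: B_def)
  have finL: "finite L" using finite_lists_length_eq[of "{..<m}" r] by (simp add: L_def conj_commute)
  have cL: "card L = m ^ r" using card_lists_length_eq[of "{..<m}" r] by (simp add: L_def conj_commute)
  have "B (Suc r) S \<subseteq> (\<lambda>(a, u). a # u) ` (T \<times> L) \<union> (\<lambda>(a, u). a # u) ` (SIGMA a:{..<m} - T. B r (?S a))"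
  proof
    fix u assume u: "u \<in> B (Suc r) S"
    then obtain a v where av: "u = a # v" by (auto simp: B_def length_Suc_conv)
    show "u \<in> (\<lambda>(a, u). a # u) ` (T \<times> L) \<union> (\<lambda>(a, u). a # u) ` (SIGMA a:{..<m} - T. B r (?S a))"
    proof (cases "a \<in> T")
      case True
      then have "(a, v) \<in> T \<times> L" using u av by (auto simp: B_def L_def)
      then show ?thesis using av by (intro UnI1) (auto intro: image_eqI[of _ _ "(a,v)"])
    next
      case False
      then have "(a, v) \<in> (SIGMA a:{..<m} - T. B r (?S a))" using u av by (auto simp: B_def)
      then show ?thesis using av by (intro UnI2) (auto intro: image_eqI[of _ _ "(a,v)"])
    qed
  qed
  then have "card (B (Suc r) S) \<le> card ((\<lambda>(a, u). a # u) ` (T \<times> L) \<union> (\<lambda>(a, u). a # u) ` (SIGMA a:{..<m} - T. B r (?S a)))"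
    using finB finL finT by (intro card_mono finite_UnI finite_imageI finite_SigmaI finite_Diff finite_lessThan) auto
  also have "\<dots> \<le> card (T \<times> L) + card (SIGMA a:{..<m} - T. B r (?S a))"
    using finB finL finT
    by (intro order_trans[OF card_Un_le] add_mono card_image_le finite_SigmaI finite_Diff finite_lessThan) auto
  also have "\<dots> \<le> (K + 1) * m ^ r + (\<Sum>a\<in>{..<m} - T. card (B r (?S a)))"
    using T cL finB mult_le_mono1[OF T, of "m ^ r"] by (subst card_SigmaI) (auto simp: card_cartesian_product)
  finally have "m * card (B (Suc r) S) \<le> m * ((K + 1) * m ^ r + (\<Sum>a\<in>{..<m} - T. card (B r (?S a))))"
    by (rule mult_le_mono2)
  then have 1: "m * card (B (Suc r) S) \<le> m * ((K + 1) * m ^ r) + (\<Sum>a\<in>{..<m} - T. m * card (B r (?S a)))"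
    by (simp only: distrib_left sum_distrib_left)
  have "m * card (B r (?S a)) \<le> r * (K + 1) * m ^ r" if "a \<in> {..<m} - T" for a
    unfolding B_def
  proof (rule Suc.IH)
    show "?S a \<subseteq> Pow {..<m}" using Suc.prems by auto
    have "card S \<le> c * card (?S a)" using that by (auto simp: T_def)
    then have "card S * 2 ^ K \<le> c * card (?S a) * 2 ^ K" by (rule mult_le_mono1)
    then have "2 ^ m * c ^ Suc r \<le> c * card (?S a) * 2 ^ K"
      using Suc.prems(2) by linarith
    then have "c * (2 ^ m * c ^ r) \<le> c * (card (?S a) * 2 ^ K)" by (simp add: ac_simps)
    then show "2 ^ m * c ^ r \<le> card (?S a) * 2 ^ K" using c0 by simp
  qed
  then have "(\<Sum>a\<in>{..<m} - T. m * card (B r (?S a))) \<le> card ({..<m} - T) * (r * (K + 1) * m ^ r)"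
    using sum_bounded_above[of "{..<m} - T" "\<lambda>a. m * card (B r (?S a))" "r * (K + 1) * m ^ r"] by simp
  also have "\<dots> \<le> m * (r * (K + 1) * m ^ r)"
    using card_mono[of "{..<m}" "{..<m} - T"] by (intro mult_le_mono1) auto
  finally have "m * card (B (Suc r) S) \<le> Suc r * (K + 1) * m ^ Suc r" using 1 by (simp add: algebra_simps)
  then show ?case by (simp only: B_def)
qed

text \<open>A union bound over the at most \<open>m ^ card I\<close> points of \<open>A\<close>; a
  list misses a given fiber only if all its entries avoid at least \<open>\<tau>\<close>
  values.\<close>

lemma card_lists_missing_fiber:
  fixes A :: "(nat \<Rightarrow> nat) set"
  assumes I: "finite I" "i \<in> I" and A: "A \<subseteq> PiE I (\<lambda>_. {..<m})" and th: "thick \<tau> I A"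
  shows "card {u. length u = r \<and> set u \<subseteq> {..<m} \<and> (\<exists>x\<in>A. \<forall>a\<in>set u. x(i := a) \<notin> A)}
    \<le> m ^ card I * (m - \<tau>) ^ r"
proof -
  have finA: "finite A" using A by (rule finite_subset) (simp add: finite_PiE I)
  have cA: "card A \<le> m ^ card I"
    using card_mono[OF _ A] by (simp add: finite_PiE I card_PiE)
  have sub: "{u. length u = r \<and> set u \<subseteq> {..<m} \<and> (\<exists>x\<in>A. \<forall>a\<in>set u. x(i := a) \<notin> A)}
      \<subseteq> (\<Union>x\<in>A. {u. set u \<subseteq> {..<m} - fiber A i x \<and> length u = r})"
    by (auto simp: fiber_def)
  have fin: "finite {u. set u \<subseteq> {..<m} - fiber A i x \<and> length u = r}" for x
    by (intro finite_lists_length_eq) simp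
  have "card {u. set u \<subseteq> {..<m} - fiber A i x \<and> length u = r} \<le> (m - \<tau>) ^ r" if "x \<in> A" for x
  proof -
    have "fiber A i x \<subseteq> {..<m}"
    proof
      fix a assume "a \<in> fiber A i x"
      then have "x(i := a) \<in> PiE I (\<lambda>_. {..<m})" using A by (auto simp: fiber_def)
      then show "a \<in> {..<m}" using I(2) by (metis PiE_mem fun_upd_same)
    qed
    then have "card ({..<m} - fiber A i x) = m - card (fiber A i x)"
      by (subst card_Diff_subset) (auto intro: finite_subset)
    also have "\<dots> \<le> m - \<tau>" using th that I(2) by (simp add: thick_def diff_le_mono2)
    finally show ?thesis by (subst card_lists_length_eq) (auto intro: power_mono)
  qed
  then have "card (\<Union>x\<in>A. {u. set u \<subseteq> {..<m} - fiber A i x \<and> length u = r}) \<le> card A * (m - \<tau>) ^ r"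
    by (intro order_trans[OF card_UN_le[OF finA]] order_trans[OF sum_bounded_above]) auto
  also have "\<dots> \<le> m ^ card I * (m - \<tau>) ^ r" using cA by (rule mult_le_mono1)
  finally show ?thesis using card_mono[OF _ sub] finA fin by (meson finite_UN_I le_trans)
qed

text \<open>Fibers of density below \<open>2 ^ -(k + 1)\<close> contain at most half of
  \<open>B\<close>. The other half lies in the rich fibers, each of at most \<open>2 ^ m\<close>
  points.\<close>

lemma card_rich_ge:
  fixes B :: "(nat \<Rightarrow> nat set) set"
  assumes I: "finite I" "i \<in> I" and B: "B \<subseteq> PiE I (\<lambda>_. Pow {..<m})"
    and big: "2 ^ (m * card I) \<le> card B * 2 ^ k"
  shows "2 ^ (m * (card I - 1)) \<le> card {w \<in> proj (I - {i}) B. 2 ^ m \<le> card (fiber B i w) * 2 ^ (k + 1)} * 2 ^ (k + 1)"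
proof -
  let ?P = "proj (I - {i}) B"
  let ?W = "{w \<in> ?P. 2 ^ m \<le> card (fiber B i w) * 2 ^ (k + 1)}"
  have finB: "finite B" using B by (rule finite_subset) (simp add: finite_PiE I)
  have finP: "finite ?P" by (simp add: finB finite_proj)
  have cI: "card I = Suc (card I - 1)" using I by (metis card_Suc_Diff1 card_Diff_singleton)
  have e: "(2::nat) ^ (m * card I) = 2 ^ m * 2 ^ (m * (card I - 1))"
    by (subst cI) (simp flip: power_add)
  have ext: "B \<subseteq> extensional I" using B by (auto simp: PiE_def)
  have sub: "?P \<subseteq> PiE (I - {i}) (\<lambda>_. Pow {..<m})" by (rule proj_subset_PiE[OF B]) auto
  have "card ?P \<le> card (PiE (I - {i}) (\<lambda>_. Pow {..<m}))"
    by (intro card_mono sub) (simp add: finite_PiE I)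
  also have "\<dots> = 2 ^ (m * (card I - 1))" using I by (simp add: card_PiE card_Pow power_mult)
  finally have cP: "card ?P \<le> 2 ^ (m * (card I - 1))" .
  have fib: "card (fiber B i w) \<le> 2 ^ m" for w
  proof -
    have "fiber B i w \<subseteq> Pow {..<m}"
    proof
      fix s assume "s \<in> fiber B i w"
      then have "w(i := s) \<in> PiE I (\<lambda>_. Pow {..<m})" using B by (auto simp: fiber_def)
      then show "s \<in> Pow {..<m}" using I(2) by (metis PiE_mem fun_upd_same)
    qed
    then have "card (fiber B i w) \<le> card (Pow {..<m})" by (intro card_mono) auto
    then show ?thesis by (simp add: card_Pow)
  qed
  have "card B = (\<Sum>w\<in>?P. card (fiber B i w))"
    by (rule card_eq_sum_fiber[OF finB ext I(2)])
  also have "\<dots> = (\<Sum>w\<in>?W. card (fiber B i w)) + (\<Sum>w\<in>?P - ?W. card (fiber B i w))"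
    using finP by (subst add.commute, intro sum.subset_diff) auto
  finally have s: "card B = (\<Sum>w\<in>?W. card (fiber B i w)) + (\<Sum>w\<in>?P - ?W. card (fiber B i w))" .
  have 1: "(\<Sum>w\<in>?W. card (fiber B i w)) \<le> card ?W * 2 ^ m"
    using sum_bounded_above[of ?W "\<lambda>w. card (fiber B i w)" "2 ^ m"] fib by simp
  have "(\<Sum>w\<in>?P - ?W. card (fiber B i w)) * 2 ^ (k + 1) = (\<Sum>w\<in>?P - ?W. card (fiber B i w) * 2 ^ (k + 1))"
    by (rule sum_distrib_right)
  also have "\<dots> \<le> card (?P - ?W) * 2 ^ m"
    using sum_bounded_above[of "?P - ?W" "\<lambda>w. card (fiber B i w) * 2 ^ (k + 1)" "2 ^ m"] by fastforce
  also have "\<dots> \<le> 2 ^ (m * (card I - 1)) * 2 ^ m"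
    using cP card_mono[OF finP, of "?P - ?W"] by (intro mult_le_mono1) auto
  also have "\<dots> \<le> card B * 2 ^ k" using big e by (simp add: mult.commute)
  finally have "2 * (\<Sum>w\<in>?P - ?W. card (fiber B i w)) \<le> card B" by simp
  then have "card B \<le> 2 * (card ?W * 2 ^ m)" using s 1 by linarith
  then have "card B * 2 ^ k \<le> 2 * (card ?W * 2 ^ m) * 2 ^ k" by (rule mult_le_mono1)
  then have "2 ^ m * 2 ^ (m * (card I - 1)) \<le> 2 * (card ?W * 2 ^ m) * 2 ^ k"
    using big e by linarith
  also have "\<dots> = 2 ^ m * (card ?W * 2 ^ (k + 1))" by simp
  finally show ?thesis by (subst (asm) mult_le_cancel1) simp
qed

lemma sum_card_swap:
  assumes "finite A" "finite B"
  shows "(\<Sum>a\<in>A. card {b \<in> B. R a b}) = (\<Sum>b\<in>B. card {a \<in> A. R a b})"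
  using assms by (intro sum_multicount_gen) auto

text \<open>This list answers a query of coordinate \<open>i\<close> by \<open>b\<close>: Alice
  keeps only values in \<open>u\<close>, and Bob only sets that contain all of \<open>u\<close>, or
  none of it. Alice then loses nothing in the other coordinates, and Bob loses two units of density:
  one for passing to rich fibers, one for the averaging over lists.\<close>

lemma exists_hitting_list:
  fixes A :: "(nat \<Rightarrow> nat) set" and B :: "(nat \<Rightarrow> nat set) set"
  assumes I: "finite I" "i \<in> I" and A: "A \<subseteq> PiE I (\<lambda>_. {..<m})" "thick \<tau> I A"
    and B: "B \<subseteq> PiE I (\<lambda>_. Pow {..<m})" "2 ^ (m * card I) \<le> card B * 2 ^ k"
    and m: "0 < m" "2 * (m ^ card I * (m - \<tau>) ^ r) < m ^ r" "4 * (r * (K + 1)) \<le> m"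
    and c: "2 * (K + 2) \<le> c" "2 ^ (k + 1) * c ^ r \<le> 2 ^ K"
  shows "\<exists>u. set u \<subseteq> {..<m} \<and> (\<forall>x\<in>A. \<exists>a\<in>set u. x(i := a) \<in> A) \<and>
    2 ^ (m * (card I - 1)) \<le>
      card {w \<in> proj (I - {i}) B. \<exists>s\<in>fiber B i w. \<forall>a\<in>set u. (a \<in> s) = b} * 2 ^ (k + 2)"
proof -
  let ?P = "proj (I - {i}) B"
  define W where "W = {w \<in> ?P. 2 ^ m \<le> card (fiber B i w) * 2 ^ (k + 1)}"
  define L where "L = {u. length u = r \<and> set u \<subseteq> {..<m}}"
  define G where "G = {u \<in> L. \<forall>x\<in>A. \<exists>a\<in>set u. x(i := a) \<in> A}"
  define miss where "miss u w \<longleftrightarrow> \<not> (\<exists>s\<in>fiber B i w. \<forall>a\<in>set u. (a \<in> s) = b)" for u w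
  have finL: "finite L" using finite_lists_length_eq[of "{..<m}" r] by (simp add: L_def conj_commute)
  have cL: "card L = m ^ r" using card_lists_length_eq[of "{..<m}" r] by (simp add: L_def conj_commute)
  have finB: "finite B" using B(1) by (rule finite_subset) (simp add: finite_PiE I)
  have finW: "finite W" by (simp add: W_def finB finite_proj)
  have cW: "2 ^ (m * (card I - 1)) \<le> card W * 2 ^ (k + 1)"
    unfolding W_def by (rule card_rich_ge[OF I B])
  have W0: "card W > 0" using cW by (intro gr0I) simp
  have "L - G = {u. length u = r \<and> set u \<subseteq> {..<m} \<and> (\<exists>x\<in>A. \<forall>a\<in>set u. x(i := a) \<notin> A)}"
    by (auto simp: L_def G_def)
  then have "card (L - G) \<le> m ^ card I * (m - \<tau>) ^ r"
    using card_lists_missing_fiber[OF I A] by simp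
  moreover have "card L = card G + card (L - G)"
    using finL card_Diff_subset[of G L] card_mono[of L G] finite_subset[of G L] by (auto simp: G_def)
  ultimately have G: "m ^ r < 2 * card G" using m(2) cL by linarith
  have missW: "4 * card {u \<in> L. miss u w} \<le> m ^ r" if w: "w \<in> W" for w
  proof -
    have "fiber B i w \<subseteq> Pow {..<m}"
    proof
      fix s assume "s \<in> fiber B i w"
      then have "w(i := s) \<in> PiE I (\<lambda>_. Pow {..<m})" using B by (auto simp: fiber_def)
      then show "s \<in> Pow {..<m}" using I(2) by (metis PiE_mem fun_upd_same)
    qed
    moreover have "2 ^ m * c ^ r \<le> card (fiber B i w) * 2 ^ K"
    proof -
      have "2 ^ m * c ^ r \<le> card (fiber B i w) * 2 ^ (k + 1) * c ^ r"
        using w by (intro mult_le_mono1) (simp add: W_def)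
      also have "\<dots> \<le> card (fiber B i w) * 2 ^ K" using c(2) by (simp only: mult.assoc mult_le_mono2)
      finally show ?thesis .
    qed
    ultimately have "m * card {u. length u = r \<and> set u \<subseteq> {..<m} \<and> miss u w} \<le> r * (K + 1) * m ^ r"
      unfolding miss_def using few_missing_lists[OF _ _ c(1)] by blast
    then have "m * card {u \<in> L. miss u w} \<le> r * (K + 1) * m ^ r"
      by (simp add: L_def conj_assoc)
    then have "4 * (m * card {u \<in> L. miss u w}) \<le> 4 * (r * (K + 1)) * m ^ r"
      by (simp only: mult.assoc mult_le_mono2)
    also have "\<dots> \<le> m * m ^ r" using m(3) by (rule mult_le_mono1)
    finally have "m * (4 * card {u \<in> L. miss u w}) \<le> m * m ^ r" by (simp add: ac_simps)
    then show ?thesis using m(1) by simp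
  qed
  \<comment> \<open>Double counting: more than half of all lists hit every fiber of
    \<open>A\<close>, while each rich \<open>w\<close> is missed by at most a quarter of all lists.
    Not every list in \<open>G\<close> can therefore miss at least half of \<open>W\<close>.\<close>
  have "\<exists>u\<in>G. card W \<le> 2 * card {w \<in> W. \<not> miss u w}"
  proof (rule ccontr)
    assume neg: "\<not> ?thesis"
    have half: "card W \<le> 2 * card {w \<in> W. miss u w}" if "u \<in> G" for u
    proof -
      have "card W = card {w \<in> W. miss u w} + card {w \<in> W. \<not> miss u w}"
        using finW by (subst card_Un_disjoint[symmetric]) (auto intro: arg_cong[where f = card])
      then show ?thesis using neg that by force
    qed
    have "card G * card W \<le> (\<Sum>u\<in>G. 2 * card {w \<in> W. miss u w})"
      using sum_bounded_below[of G "card W" "\<lambda>u. 2 * card {w \<in> W. miss u w}"] half by simp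
    also have "\<dots> \<le> (\<Sum>u\<in>L. 2 * card {w \<in> W. miss u w})"
      using finL by (intro sum_mono2) (auto simp: G_def)
    also have "\<dots> = 2 * (\<Sum>w\<in>W. card {u \<in> L. miss u w})"
      by (simp add: sum_card_swap[OF finL finW] flip: sum_distrib_left)
    finally have "2 * (card G * card W) \<le> (\<Sum>w\<in>W. 4 * card {u \<in> L. miss u w})"
      unfolding sum_distrib_left[symmetric] by linarith
    also have "\<dots> \<le> card W * m ^ r"
      using sum_bounded_above[of W "\<lambda>w. 4 * card {u \<in> L. miss u w}" "m ^ r"] missW by simp
    finally have "card W * (2 * card G) \<le> card W * m ^ r" by (simp add: ac_simps)
    then show False using G W0 by simp
  qed
  then obtain u where u: "u \<in> G" "card W \<le> 2 * card {w \<in> W. \<not> miss u w}" by blast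
  have "card {w \<in> W. \<not> miss u w} \<le> card {w \<in> ?P. \<exists>s\<in>fiber B i w. \<forall>a\<in>set u. (a \<in> s) = b}"
    by (intro card_mono) (auto simp: W_def miss_def finB finite_proj)
  then have "card W \<le> 2 * card {w \<in> ?P. \<exists>s\<in>fiber B i w. \<forall>a\<in>set u. (a \<in> s) = b}"
    using u(2) by linarith
  then have 2: "card W * 2 ^ (k + 1) \<le> 2 * card {w \<in> ?P. \<exists>s\<in>fiber B i w. \<forall>a\<in>set u. (a \<in> s) = b} * 2 ^ (k + 1)"
    by (rule mult_le_mono1)
  then have "2 ^ (m * (card I - 1)) \<le> card {w \<in> ?P. \<exists>s\<in>fiber B i w. \<forall>a\<in>set u. (a \<in> s) = b} * 2 ^ (k + 2)"
    using order_trans[OF cW 2] by (simp add: ac_simps)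
  then show ?thesis using u(1) unfolding G_def L_def by blast
qed

section \<open>Simulation of protocols by queries\<close>

text \<open>
  In the constraints below \<open>\<tau>\<close> is the minimal degree that pruning can restore in an average
  degree \<open>m/8\<close>, \<open>r\<close> the length of the hitting lists, and \<open>k0\<close> bounds the density deficit of Bob's
  side during the whole simulation.
\<close>

locale simulation =
  fixes V :: "nat set" and m \<tau> r K c k0 :: nat
  assumes finV: "finite V" and m0: "0 < m"
    and prune: "16 * \<tau> * card V \<le> m"
    and hitA: "2 * (m ^ card V * (m - \<tau>) ^ r) < m ^ r"
    and hitB: "4 * (r * (K + 1)) \<le> m" "2 * (K + 2) \<le> c" "2 ^ (k0 + 1) * c ^ r \<le> 2 ^ K"
begin

text \<open>\<open>I\<close> holds the unqueried coordinates. The sets keep all coordinates, since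
  the protocol runs on full inputs, but sizes are measured on \<open>I\<close> only. Alice's density
  is tracked separately in \<open>sim_state\<close>.\<close>

definition state :: "nat set \<Rightarrow> (nat \<Rightarrow> nat) set \<Rightarrow> (nat \<Rightarrow> nat set) set \<Rightarrow> nat \<Rightarrow> bool" where
  "state I X Y k \<longleftrightarrow> I \<subseteq> V \<and> X \<subseteq> PiE V (\<lambda>_. {..<m}) \<and> X \<noteq> {} \<and> Y \<subseteq> PiE V (\<lambda>_. Pow {..<m}) \<and>
     2 ^ (m * card I) \<le> card (proj I Y) * 2 ^ k"

lemma state_finite:
  assumes "state I X Y k"
  shows "finite I" "finite X" "finite Y" "card I \<le> card V" "Y \<noteq> {}"
proof -
  have "I \<subseteq> V" "X \<subseteq> PiE V (\<lambda>_. {..<m})" "Y \<subseteq> PiE V (\<lambda>_. Pow {..<m})"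
    using assms by (auto simp: state_def)
  then show "finite I" "finite X" "finite Y" "card I \<le> card V"
    using finV by (auto intro: finite_subset finite_PiE card_mono)
  show "Y \<noteq> {}" using assms by (intro notI) (simp add: state_def proj_def)
qed

lemma restrict_coordinate:
  assumes st: "state I X Y k" and k: "k \<le> k0" and i: "i \<in> I" and th: "thick \<tau> I (proj I X)"
  shows "\<exists>X'\<subseteq>X. \<exists>Y'\<subseteq>Y. state (I - {i}) X' Y' (k + 2) \<and> (\<forall>x\<in>X'. \<forall>y\<in>Y'. (x i \<in> y i) = b) \<and>
    proj (I - {i}) X' = proj (I - {i}) X"
proof -
  have I: "I \<subseteq> V" "X \<subseteq> PiE V (\<lambda>_. {..<m})" "X \<noteq> {}" "Y \<subseteq> PiE V (\<lambda>_. Pow {..<m})"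
    and big: "2 ^ (m * card I) \<le> card (proj I Y) * 2 ^ k" using st by (auto simp: state_def)
  note fin = state_finite[OF st]
  have "m ^ card I \<le> m ^ card V" using fin(4) m0 by (intro power_increasing) auto
  then have "2 * (m ^ card I * (m - \<tau>) ^ r) \<le> 2 * (m ^ card V * (m - \<tau>) ^ r)" by simp
  then have hA: "2 * (m ^ card I * (m - \<tau>) ^ r) < m ^ r" using hitA by linarith
  have "(2::nat) ^ (k + 1) * c ^ r \<le> 2 ^ (k0 + 1) * c ^ r"
    using k by (intro mult_le_mono1 power_increasing) auto
  then have hB: "2 ^ (k + 1) * c ^ r \<le> 2 ^ K" using hitB(3) by linarith
  obtain u where u: "set u \<subseteq> {..<m}" "\<forall>x\<in>proj I X. \<exists>a\<in>set u. x(i := a) \<in> proj I X"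
    "2 ^ (m * (card I - 1)) \<le>
      card {w \<in> proj (I - {i}) (proj I Y). \<exists>s\<in>fiber (proj I Y) i w. \<forall>a\<in>set u. (a \<in> s) = b} * 2 ^ (k + 2)"
    using exists_hitting_list[OF fin(1) i proj_subset_PiE[OF I(2,1)] th proj_subset_PiE[OF I(4,1)] big m0 hA
      hitB(1,2) hB] by blast
  define X' where "X' = {x \<in> X. x i \<in> set u}"
  define Y' where "Y' = {y \<in> Y. \<forall>a\<in>set u. (a \<in> y i) = b}"
  have pX: "proj (I - {i}) X' = proj (I - {i}) X"
  proof
    show "proj (I - {i}) X \<subseteq> proj (I - {i}) X'"
    proof
      fix w assume "w \<in> proj (I - {i}) X"
      then obtain x where x: "x \<in> X" "w = restrict x (I - {i})" by (auto simp: proj_def)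
      then have "restrict x I \<in> proj I X" by (auto simp: proj_def)
      then obtain a where a: "a \<in> set u" "(restrict x I)(i := a) \<in> proj I X" using u(2) by blast
      then obtain x2 where x2: "x2 \<in> X" "(restrict x I)(i := a) = restrict x2 I" by (auto simp: proj_def)
      have "x2 i = a" using x2(2) i by (metis fun_upd_same restrict_apply')
      moreover have "restrict x2 (I - {i}) = w"
      proof
        fix j show "restrict x2 (I - {i}) j = w j"
          using fun_cong[OF x2(2), of j] x(2) by (auto split: if_splits)
      qed
      ultimately show "w \<in> proj (I - {i}) X'" using x2(1) a(1) by (auto simp: X'_def proj_def)
    qed
  qed (auto simp: X'_def intro!: proj_mono)
  have "{w \<in> proj (I - {i}) (proj I Y). \<exists>s\<in>fiber (proj I Y) i w. \<forall>a\<in>set u. (a \<in> s) = b} \<subseteq> proj (I - {i}) Y'"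
  proof clarify
    fix w s assume w: "w \<in> proj (I - {i}) (proj I Y)" "s \<in> fiber (proj I Y) i w" "\<forall>a\<in>set u. (a \<in> s) = b"
    have "w i = undefined" and wext: "w \<in> extensional (I - {i})" using w(1) by (auto simp: proj_def)
    obtain y where y: "y \<in> Y" "w(i := s) = restrict y I" using w(2) by (auto simp: fiber_def proj_def)
    have "y i = s" using y(2) i by (metis fun_upd_same restrict_apply')
    then have "y \<in> Y'" using y(1) w(3) by (auto simp: Y'_def)
    moreover have "w = restrict y (I - {i})"
    proof
      fix j show "w j = restrict y (I - {i}) j"
        using fun_cong[OF y(2), of j] \<open>w i = undefined\<close> wext by (auto split: if_splits simp: extensional_def)
    qed
    ultimately show "w \<in> proj (I - {i}) Y'" by (auto simp: proj_def)
  qed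
  moreover have "finite (proj (I - {i}) Y')" using fin(3) by (auto simp: Y'_def intro: finite_proj)
  ultimately have "2 ^ (m * (card I - 1)) \<le> card (proj (I - {i}) Y') * 2 ^ (k + 2)"
    using u(3) by (meson card_mono le_trans mult_le_mono1)
  moreover have "X' \<noteq> {}" using pX I(3) by (metis proj_empty_iff)
  moreover have "X' \<subseteq> X" "Y' \<subseteq> Y" by (auto simp: X'_def Y'_def)
  ultimately have "state (I - {i}) X' Y' (k + 2)"
    using I i fin(1) unfolding state_def card_Diff_singleton[OF i] by blast
  then show ?thesis using pX
    by (intro exI[of _ X'] exI[of _ Y'] conjI) (auto simp: X'_def Y'_def)
qed

lemma thick_proj_remove:
  assumes "finite X" "thick \<tau> I (proj I X)" "proj (I - {i}) X' = proj (I - {i}) X"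
  shows "thick \<tau> (I - {i}) (proj (I - {i}) X')"
proof -
  have "thick \<tau> (I - {i}) (proj (I - {i}) (proj I X))"
    using assms by (intro thick_proj finite_proj) auto
  then show ?thesis using assms(3) by (simp add: proj_proj)
qed

text \<open>The coordinates are fixed one by one to the values of \<open>z\<close>. Thickness
  survives because Alice's remaining projection does not change, and Bob can afford two units per
  coordinate.\<close>

lemma state_attains_all:
  assumes "state I X Y k" "thick \<tau> I (proj I X)" "k + 2 * card I \<le> k0"
  shows "\<exists>x\<in>X. \<exists>y\<in>Y. \<forall>i\<in>I. (x i \<in> y i) = z i"
  using assms
proof (induction "card I" arbitrary: I X Y k)
  case 0
  then have "I = {}" "X \<noteq> {}" "Y \<noteq> {}" using state_finite[OF 0(2)] by (auto simp: state_def)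
  then show ?case by blast
next
  case (Suc n)
  then have "I \<noteq> {}" by (intro notI) simp
  then obtain i where i: "i \<in> I" by blast
  note fin = state_finite[OF Suc.prems(1)]
  have "k \<le> k0" using Suc.prems by simp
  then obtain X' Y' where X': "X' \<subseteq> X" "Y' \<subseteq> Y" "state (I - {i}) X' Y' (k + 2)"
    "\<forall>x\<in>X'. \<forall>y\<in>Y'. (x i \<in> y i) = z i" "proj (I - {i}) X' = proj (I - {i}) X"
    using restrict_coordinate[OF Suc.prems(1) _ i Suc.prems(2), of "z i"] by blast
  have "n = card (I - {i})" using Suc.hyps(2) i fin(1) by simp
  moreover have "k + 2 + 2 * card (I - {i}) \<le> k0"
    using Suc.prems(3) Suc.hyps(2) \<open>n = card (I - {i})\<close> by linarith
  ultimately obtain x y where xy: "x \<in> X'" "y \<in> Y'" "\<forall>j\<in>I - {i}. (x j \<in> y j) = z j"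
    using Suc.hyps(1)[OF _ X'(3) thick_proj_remove[OF fin(2) Suc.prems(2) X'(5)]] by blast
  have "(x i \<in> y i) = z i" using X'(4) xy(1,2) by blast
  then have "\<forall>j\<in>I. (x j \<in> y j) = z j" using xy(3) by (metis DiffI singletonD)
  then show ?case using X'(1,2) xy(1,2) by blast
qed

text \<open>Passing to \<open>X1\<close> lowers the average degrees from \<open>m / 4\<close> to no
  less than \<open>m / 8\<close>, which is enough for pruning. Each of the two operations costs a
  factor 2.\<close>

lemma exists_thick_state:
  assumes st: "state I X Y k" and X1: "X1 \<subseteq> X" "card (proj I X) \<le> 2 * card (proj I X1)"
    and avg: "\<And>i. i \<in> I \<Longrightarrow> m * card (proj (I - {i}) X) \<le> 4 * card (proj I X)"
  shows "\<exists>X'\<subseteq>X1. state I X' Y k \<and> thick \<tau> I (proj I X') \<and> card (proj I X) \<le> 4 * card (proj I X')"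
proof -
  note fin = state_finite[OF st]
  have finX1: "finite X1" using X1 fin finite_subset by blast
  have "m * card (proj (I - {i}) (proj I X1)) \<le> 8 * card (proj I X1)" if "i \<in> I" for i
  proof -
    have "proj (I - {i}) (proj I X1) = proj (I - {i}) X1" by (rule proj_proj) auto
    moreover have "card (proj (I - {i}) X1) \<le> card (proj (I - {i}) X)"
      using fin(2) X1 by (intro card_mono finite_proj proj_mono)
    ultimately have "m * card (proj (I - {i}) (proj I X1)) \<le> m * card (proj (I - {i}) X)" by simp
    then show ?thesis using avg[OF that] X1(2) by linarith
  qed
  moreover have "16 * \<tau> * card I \<le> m"
    using prune fin(4) by (meson le_trans mult_le_mono2)
  ultimately obtain A where A: "A \<subseteq> proj I X1" "thick \<tau> I A" "card (proj I X1) \<le> 2 * card A"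
    using thick_subset_half[OF fin(1) finite_proj[OF finX1] proj_subset_extensional, of m \<tau>] m0 by blast
  define X' where "X' = {x \<in> X1. restrict x I \<in> A}"
  have p: "proj I X' = A" using A(1) by (auto simp: X'_def proj_def)
  have "X \<noteq> {}" using st by (simp add: state_def)
  then have "card (proj I X) > 0" using fin by (simp add: card_gt_0_iff finite_proj)
  then have "A \<noteq> {}" using X1 A(3) by (intro notI) simp
  then have "X' \<noteq> {}" using p by (metis proj_empty_iff)
  then have "state I X' Y k" using st X1 by (auto simp: state_def X'_def)
  then show ?thesis using p A X1 by (intro exI[of _ X']) (auto simp: X'_def)
qed

text \<open>\<open>q\<close> is the hardness left to the query adversary, \<open>p\<close> and
  \<open>k\<close> are the density deficits of Alice and Bob. The last clause says that the gadgets
  already queried output the answers shared by all of \<open>Z\<close>.\<close>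

definition sim_state ::
  "((nat \<Rightarrow> bool) \<Rightarrow> bool) \<Rightarrow> nat set \<Rightarrow> (nat \<Rightarrow> nat) set \<Rightarrow> (nat \<Rightarrow> nat set) set \<Rightarrow> (nat \<Rightarrow> bool) set \<Rightarrow>
     nat \<Rightarrow> nat \<Rightarrow> nat \<Rightarrow> bool" where
  "sim_state f I X Y Z q p k \<longleftrightarrow> state I X Y k \<and> m ^ card I \<le> card (proj I X) * 2 ^ p \<and> hard f q Z \<and>
     (\<forall>z\<in>Z. \<forall>i\<in>V - I. \<forall>x\<in>X. \<forall>y\<in>Y. (x i \<in> y i) = z i)"

text \<open>Average degree at least \<open>m / 4\<close> in every unqueried coordinate.\<close>

definition balanced :: "nat set \<Rightarrow> (nat \<Rightarrow> nat) set \<Rightarrow> bool" where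
  "balanced I X \<longleftrightarrow> (\<forall>i\<in>I. m * card (proj (I - {i}) X) \<le> 4 * card (proj I X))"

section \<open>Maintaining the invariant through queries and bits\<close>

lemma sim_state_subset:
  assumes sim: "sim_state f I X Y Z q p k" and sub: "X' \<subseteq> X" "Y' \<subseteq> Y"
    and st: "state I X' Y' k'" and p': "m ^ card I \<le> card (proj I X') * 2 ^ p'"
  shows "sim_state f I X' Y' Z q p' k'"
proof -
  have "hard f q Z" and old: "\<forall>z\<in>Z. \<forall>i\<in>V - I. \<forall>x\<in>X. \<forall>y\<in>Y. (x i \<in> y i) = z i"
    using sim by (auto simp: sim_state_def)
  moreover have "(x i \<in> y i) = z i" if "z \<in> Z" "i \<in> V - I" "x \<in> X'" "y \<in> Y'" for z i x y
    using bspec[OF bspec[OF bspec[OF bspec[OF old that(1)] that(2)] subsetD[OF sub(1) that(3)]] subsetD[OF sub(2) that(4)]] .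
  ultimately show ?thesis using st p' by (simp add: sim_state_def)
qed

text \<open>Every coordinate of small average degree is queried; this pays for itself, since
  projecting it away lowers the deficit \<open>p\<close> of Alice's side by 2.\<close>

lemma query_until_balanced:
  assumes "sim_state f I X Y Z q p k" "thick \<tau> I (proj I X)" "k + 2 * card I + d \<le> k0"
    and "\<And>I X' Y' Z q p k. sim_state f I X' Y' Z q p k \<Longrightarrow> balanced I X' \<Longrightarrow> X' \<subseteq> X \<Longrightarrow> Y' \<subseteq> Y \<Longrightarrow>
      k + 2 * card I + d \<le> k0 \<Longrightarrow> 2 * q \<le> p + 2 * d"
  shows "2 * q \<le> p + 2 * d"
  using assms
proof (induction "card I" arbitrary: I X Y Z q p k rule: less_induct)
  case less
  note sim = less.prems(1)
  have st: "state I X Y k" using sim by (simp add: sim_state_def)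
  note fin = state_finite[OF st]
  show ?case
  proof (cases "balanced I X \<or> q = 0")
    case True then show ?thesis using less.prems by auto
  next
    case False
    then obtain i where i: "i \<in> I" "4 * card (proj I X) < m * card (proj (I - {i}) X)"
      by (auto simp: balanced_def not_le)
    obtain q' where q: "q = Suc q'" using False by (cases q) auto
    have "hard f (Suc q') Z" using sim q by (simp add: sim_state_def del: hard.simps)
    then obtain b where b: "hard f q' {z \<in> Z. z i = b}" unfolding hard.simps by blast
    have "k \<le> k0" using less.prems(3) by simp
    then obtain X' Y' where X': "X' \<subseteq> X" "Y' \<subseteq> Y" "state (I - {i}) X' Y' (k + 2)"
      "\<forall>x\<in>X'. \<forall>y\<in>Y'. (x i \<in> y i) = b" "proj (I - {i}) X' = proj (I - {i}) X"
      using restrict_coordinate[OF st _ i(1) less.prems(2), of b] by blast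
    have cI: "card I = Suc (card (I - {i}))" using i(1) fin(1) by (metis card_Suc_Diff1)
    let ?P = "proj (I - {i}) X"
    have "m ^ card I \<le> card (proj I X) * 2 ^ p" using sim by (simp add: sim_state_def)
    then have "4 * m ^ card I \<le> 4 * card (proj I X) * 2 ^ p" by simp
    also have "\<dots> < m * card ?P * 2 ^ p" using i(2) by (intro mult_strict_right_mono) auto
    finally have "m * (4 * m ^ card (I - {i})) < m * (card ?P * 2 ^ p)" by (simp add: cI ac_simps)
    then have 4: "4 * m ^ card (I - {i}) < card ?P * 2 ^ p" using m0 by simp
    \<comment> \<open>The projection has density above \<open>4 * 2 ^ -p\<close> and at most 1, so
      \<open>2 < p\<close> and the deficit can be lowered by 2 without truncation.\<close>
    have "?P \<subseteq> PiE (I - {i}) (\<lambda>_. {..<m})"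
      using st by (intro proj_subset_PiE[where V = V]) (auto simp: state_def)
    then have "card ?P \<le> m ^ card (I - {i})"
      using fin(1) card_mono[of "PiE (I - {i}) (\<lambda>_. {..<m})" ?P] by (simp add: finite_PiE card_PiE)
    then have "card ?P * 2 ^ p \<le> m ^ card (I - {i}) * 2 ^ p" by (rule mult_le_mono1)
    then have "m ^ card (I - {i}) * 4 < m ^ card (I - {i}) * 2 ^ p" using 4 by linarith
    then have "(2::nat) ^ 2 < 2 ^ p" by simp
    then have "2 < p" by (subst (asm) power_strict_increasing_iff) auto
    then obtain p' where p: "p = p' + 2" by (metis add.commute less_imp_add_positive)
    have p': "m ^ card (I - {i}) \<le> card (proj (I - {i}) X') * 2 ^ p'"
      using 4 by (simp add: X'(5) p power_add)
    have cons: "\<forall>z\<in>{z \<in> Z. z i = b}. \<forall>j\<in>V - (I - {i}). \<forall>x\<in>X'. \<forall>y\<in>Y'. (x j \<in> y j) = z j"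
    proof clarify
      fix z j x y assume "z \<in> Z" "b = z i" "j \<in> V" "j \<notin> I - {i}" "x \<in> X'" "y \<in> Y'"
      moreover have old: "\<forall>z\<in>Z. \<forall>i\<in>V - I. \<forall>x\<in>X. \<forall>y\<in>Y. (x i \<in> y i) = z i"
        using sim by (simp add: sim_state_def)
      ultimately show "(x j \<in> y j) = z j"
      proof (cases "j = i")
        case True
        have "(x i \<in> y i) = b" using X'(4) \<open>x \<in> X'\<close> \<open>y \<in> Y'\<close> by blast
        then show ?thesis using True \<open>b = z i\<close> by simp
      next
        case False
        then have "j \<in> V - I" "x \<in> X" "y \<in> Y"
          using \<open>j \<in> V\<close> \<open>j \<notin> I - {i}\<close> \<open>x \<in> X'\<close> \<open>y \<in> Y'\<close> X'(1,2) by auto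
        then show ?thesis using old \<open>z \<in> Z\<close> by blast
      qed
    qed
    have sim': "sim_state f (I - {i}) X' Y' {z \<in> Z. z i = b} q' p' (k + 2)"
      unfolding sim_state_def using X'(3) p' b cons by blast
    \<comment> \<open>A query moves two units from \<open>2 * card I\<close> to \<open>k\<close>, so
      this budget reserves two units for each coordinate, queried or not, and one for each remaining
      bit.\<close>
    have k': "k + 2 + 2 * card (I - {i}) + d \<le> k0" using less.prems(3) cI by simp
    have "2 * q' \<le> p' + 2 * d"
    proof (rule less.hyps[OF _ sim' thick_proj_remove[OF fin(2) less.prems(2) X'(5)] k'])
      show "card (I - {i}) < card I" using cI by simp
    next
      fix J X'' Y'' Z q p k
      assume a: "sim_state f J X'' Y'' Z q p k" "balanced J X''" "X'' \<subseteq> X'" "Y'' \<subseteq> Y'" "k + 2 * card J + d \<le> k0"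
      show "2 * q \<le> p + 2 * d"
        by (rule less.prems(4)[OF a(1,2) order_trans[OF a(3) X'(1)] order_trans[OF a(4) X'(2)] a(5)])
    qed
    then show ?thesis using q p by simp
  qed
qed

lemma alice_step:
  assumes sim: "sim_state f I X Y Z q p k" and bal: "balanced I X" and k: "k + 2 * card I + d \<le> k0"
    and X1: "X1 \<subseteq> X" "card (proj I X) \<le> 2 * card (proj I X1)"
    and rest: "\<And>I X' Y' Z q p k. sim_state f I X' Y' Z q p k \<Longrightarrow> balanced I X' \<Longrightarrow> X' \<subseteq> X1 \<Longrightarrow> Y' \<subseteq> Y \<Longrightarrow>
      k + 2 * card I + d \<le> k0 \<Longrightarrow> 2 * q \<le> p + 2 * d"
  shows "2 * q \<le> p + 2 * Suc d"
proof -
  have st: "state I X Y k" using sim by (simp add: sim_state_def)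
  obtain X' where X': "X' \<subseteq> X1" "state I X' Y k" "thick \<tau> I (proj I X')"
      "card (proj I X) \<le> 4 * card (proj I X')"
    using exists_thick_state[OF st X1] bal by (auto simp: balanced_def)
  have "m ^ card I \<le> card (proj I X) * 2 ^ p" using sim by (simp add: sim_state_def)
  also have "\<dots> \<le> 4 * card (proj I X') * 2 ^ p" by (rule mult_le_mono1[OF X'(4)])
  finally have "m ^ card I \<le> card (proj I X') * 2 ^ (p + 2)" by (simp add: ac_simps)
  moreover have "X' \<subseteq> X" using X'(1) X1(1) by blast
  ultimately have "sim_state f I X' Y Z q (p + 2) k"
    by (intro sim_state_subset[OF sim _ _ X'(2)]) auto
  then have "2 * q \<le> (p + 2) + 2 * d"
  proof (rule query_until_balanced[OF _ X'(3) k])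
    fix J X'' Y'' Z q p k
    assume a: "sim_state f J X'' Y'' Z q p k" "balanced J X''" "X'' \<subseteq> X'" "Y'' \<subseteq> Y" "k + 2 * card J + d \<le> k0"
    show "2 * q \<le> p + 2 * d"
      by (rule rest[OF a(1,2) order_trans[OF a(3) X'(1)] a(4,5)])
  qed
  then show ?thesis by simp
qed

text \<open>At a leaf every \<open>z\<close> in \<open>Z\<close> is realised by an input pair, so
  \<open>f\<close> is constant on \<open>Z\<close> and \<open>q = 0\<close>. An Alice node keeps the
  larger part, prunes and queries; the 2 added to \<open>p\<close> is paid by the lost bit. A Bob
  node changes only \<open>k\<close>, so Alice's side stays balanced.\<close>

lemma sim_state_bits:
  assumes dep: "\<And>z z'. (\<And>i. i \<in> V \<Longrightarrow> z i = z' i) \<Longrightarrow> f z = f z'"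
    and "sim_state f I X Y Z q p k" "balanced I X" "k + 2 * card I + d \<le> k0"
    and "\<forall>x\<in>X. \<forall>y\<in>Y. run P x y = f (\<lambda>i. x i \<in> y i) \<and> bits P x y \<le> d"
  shows "2 * q \<le> p + 2 * d"
  using assms(2-)
proof (induction P arbitrary: I X Y Z q p k d)
  case (Output c)
  have st: "state I X Y k" using Output by (simp add: sim_state_def)
  obtain X' where X': "X' \<subseteq> X" "state I X' Y k" "thick \<tau> I (proj I X')"
    using exists_thick_state[OF st, of X] Output.prems(2) by (auto simp: balanced_def)
  have k: "k + 2 * card I \<le> k0" using Output.prems(3) by simp
  have "f z = c" if z: "z \<in> Z" for z
  proof -
    obtain x y where xy: "x \<in> X'" "y \<in> Y" "\<forall>i\<in>I. (x i \<in> y i) = z i"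
      using state_attains_all[OF X'(2,3) k] by blast
    have x: "x \<in> X" using xy X'(1) by blast
    have "\<forall>z\<in>Z. \<forall>i\<in>V - I. \<forall>x\<in>X. \<forall>y\<in>Y. (x i \<in> y i) = z i"
      using Output.prems(1) by (simp add: sim_state_def)
    then have "f (\<lambda>i. x i \<in> y i) = f z"
      using xy(2,3) x z by (intro dep) (metis DiffI)
    moreover have "run (Output c) x y = f (\<lambda>i. x i \<in> y i)" using Output.prems(4) xy(2) x by blast
    ultimately show ?thesis by simp
  qed
  then have "\<not> hard f (Suc q') Z" for q' unfolding hard.simps by blast
  then show ?case using Output.prems(1) by (cases q) (auto simp: sim_state_def simp del: hard.simps)
next
  case (Alice h P Q)
  have st: "state I X Y k" using Alice.prems by (simp add: sim_state_def)
  obtain x y where "x \<in> X" "y \<in> Y" using st state_finite(5)[OF st] by (auto simp: state_def)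
  then have "bits (Alice h P Q) x y \<le> d" using Alice.prems(4) by blast
  then obtain d' where d: "d = Suc d'" by (cases d) auto
  let ?T = "{x \<in> X. h x}" and ?F = "{x \<in> X. \<not> h x}"
  have "proj I X = proj I ?T \<union> proj I ?F" by (auto simp: proj_def)
  then have half: "card (proj I X) \<le> card (proj I ?T) + card (proj I ?F)" by (simp add: card_Un_le)
  have k: "k + 2 * card I + d' \<le> k0" using Alice.prems(3) d by simp
  consider "card (proj I X) \<le> 2 * card (proj I ?T)" | "card (proj I X) \<le> 2 * card (proj I ?F)"
    using half by linarith
  then show ?case
  proof cases
    case 1
    have step: "2 * q' \<le> p' + 2 * d'"
      if "sim_state f I' X' Y' Z' q' p' k'" "balanced I' X'" "X' \<subseteq> ?T" "Y' \<subseteq> Y" "k' + 2 * card I' + d' \<le> k0"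
      for I' X' Y' Z' q' p' k'
    proof (rule Alice.IH(1)[OF that(1,2,5)], intro ballI)
      fix x y assume "x \<in> X'" "y \<in> Y'"
      then have "x \<in> X" "h x" "y \<in> Y" using that(3,4) by auto
      then have "run (Alice h P Q) x y = f (\<lambda>i. x i \<in> y i) \<and> bits (Alice h P Q) x y \<le> d"
        using Alice.prems(4) by blast
      then show "run P x y = f (\<lambda>i. x i \<in> y i) \<and> bits P x y \<le> d'" using d \<open>h x\<close> by simp
    qed
    show ?thesis
      unfolding d by (rule alice_step[OF Alice.prems(1,2) k _ 1 step]) auto
  next
    case 2
    have step: "2 * q' \<le> p' + 2 * d'"
      if "sim_state f I' X' Y' Z' q' p' k'" "balanced I' X'" "X' \<subseteq> ?F" "Y' \<subseteq> Y" "k' + 2 * card I' + d' \<le> k0"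
      for I' X' Y' Z' q' p' k'
    proof (rule Alice.IH(2)[OF that(1,2,5)], intro ballI)
      fix x y assume "x \<in> X'" "y \<in> Y'"
      then have "x \<in> X" "\<not> h x" "y \<in> Y" using that(3,4) by auto
      then have "run (Alice h P Q) x y = f (\<lambda>i. x i \<in> y i) \<and> bits (Alice h P Q) x y \<le> d"
        using Alice.prems(4) by blast
      then show "run Q x y = f (\<lambda>i. x i \<in> y i) \<and> bits Q x y \<le> d'" using d \<open>\<not> h x\<close> by simp
    qed
    show ?thesis
      unfolding d by (rule alice_step[OF Alice.prems(1,2) k _ 2 step]) auto
  qed
next
  case (Bob h P Q)
  have st: "state I X Y k" using Bob.prems by (simp add: sim_state_def)
  obtain x y where "x \<in> X" "y \<in> Y" using st state_finite(5)[OF st] by (auto simp: state_def)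
  then have "bits (Bob h P Q) x y \<le> d" using Bob.prems(4) by blast
  then obtain d' where d: "d = Suc d'" by (cases d) auto
  let ?T = "{y \<in> Y. h y}" and ?F = "{y \<in> Y. \<not> h y}"
  have "proj I Y = proj I ?T \<union> proj I ?F" by (auto simp: proj_def)
  then have half: "card (proj I Y) \<le> card (proj I ?T) + card (proj I ?F)" by (simp add: card_Un_le)
  have k: "k + 1 + 2 * card I + d' \<le> k0" using Bob.prems(3) d by simp
  have sim: "sim_state f I X Y1 Z q p (k + 1)" if "Y1 \<subseteq> Y" "card (proj I Y) \<le> 2 * card (proj I Y1)" for Y1
  proof -
    have "2 ^ (m * card I) \<le> card (proj I Y) * 2 ^ k" using st by (simp add: state_def)
    also have "\<dots> \<le> 2 * card (proj I Y1) * 2 ^ k" by (rule mult_le_mono1[OF that(2)])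
    finally have "2 ^ (m * card I) \<le> card (proj I Y1) * 2 ^ (k + 1)" by (simp add: ac_simps)
    moreover have "Y1 \<subseteq> PiE V (\<lambda>_. Pow {..<m})"
      by (rule order_trans[OF that(1)]) (use st in \<open>simp add: state_def\<close>)
    ultimately have "state I X Y1 (k + 1)" using st unfolding state_def by simp
    then show ?thesis
      using Bob.prems(1) by (intro sim_state_subset[OF Bob.prems(1) order_refl that(1)]) (simp_all add: sim_state_def)
  qed
  consider "card (proj I Y) \<le> 2 * card (proj I ?T)" | "card (proj I Y) \<le> 2 * card (proj I ?F)"
    using half by linarith
  then have "2 * q \<le> p + 2 * d'"
  proof cases
    case 1
    have sub: "?T \<subseteq> Y" by auto
    show ?thesis
    proof (rule Bob.IH(1)[OF sim[OF sub 1] Bob.prems(2) k], intro ballI)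
      fix x y assume "x \<in> X" "y \<in> ?T"
      then have "run (Bob h P Q) x y = f (\<lambda>i. x i \<in> y i) \<and> bits (Bob h P Q) x y \<le> d"
        using Bob.prems(4) by blast
      then show "run P x y = f (\<lambda>i. x i \<in> y i) \<and> bits P x y \<le> d'" using d \<open>y \<in> ?T\<close> by simp
    qed
  next
    case 2
    have sub: "?F \<subseteq> Y" by auto
    show ?thesis
    proof (rule Bob.IH(2)[OF sim[OF sub 2] Bob.prems(2) k], intro ballI)
      fix x y assume "x \<in> X" "y \<in> ?F"
      then have "run (Bob h P Q) x y = f (\<lambda>i. x i \<in> y i) \<and> bits (Bob h P Q) x y \<le> d"
        using Bob.prems(4) by blast
      then show "run Q x y = f (\<lambda>i. x i \<in> y i) \<and> bits Q x y \<le> d'" using d \<open>y \<in> ?F\<close> by simp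
    qed
  qed
  then show ?case using d by simp
qed

lemma hard_le_bits:
  assumes dep: "\<And>z z'. (\<And>i. i \<in> V \<Longrightarrow> z i = z' i) \<Longrightarrow> f z = f z'"
    and "hard f q UNIV" "2 * card V + d \<le> k0"
    and P: "\<forall>x\<in>PiE V (\<lambda>_. {..<m}). \<forall>y\<in>PiE V (\<lambda>_. Pow {..<m}). run P x y = f (\<lambda>i. x i \<in> y i) \<and> bits P x y \<le> d"
  shows "q \<le> d"
proof -
  let ?X = "PiE V (\<lambda>_. {..<m})" and ?Y = "PiE V (\<lambda>_. Pow {..<m})"
  have X: "proj V ?X = ?X" and Y: "proj V ?Y = ?Y" by (auto intro!: proj_self simp: PiE_def)
  have cX: "card ?X = m ^ card V" using finV by (simp add: card_PiE)
  have cY: "card ?Y = 2 ^ (m * card V)" using finV by (simp add: card_PiE card_Pow power_mult)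
  have "?X \<noteq> {}" using m0 by (auto simp: PiE_eq_empty_iff)
  then have sim: "sim_state f V ?X ?Y UNIV q 0 0"
    using assms(2) X Y cX cY by (auto simp: sim_state_def state_def)
  have bal: "balanced V ?X"
    unfolding balanced_def
  proof
    fix i assume i: "i \<in> V"
    have "card (proj (V - {i}) ?X) \<le> card (PiE (V - {i}) (\<lambda>_. {..<m}))"
      using finV by (intro card_mono proj_subset_PiE[where V = V] finite_PiE) auto
    also have "\<dots> = m ^ card (V - {i})" using finV by (simp add: card_PiE)
    finally have "m * card (proj (V - {i}) ?X) \<le> m * m ^ card (V - {i})" by simp
    also have "\<dots> = m ^ card V" using i finV by (metis card_Suc_Diff1 power_Suc)
    finally show "m * card (proj (V - {i}) ?X) \<le> 4 * card (proj V ?X)" using X cX by simp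
  qed
  have "2 * q \<le> 0 + 2 * d"
    by (rule sim_state_bits[OF dep sim bal _ P]) (use assms(3) in auto)
  then show ?thesis by simp
qed

end

section \<open>Partition number and protocols\<close>

text \<open>The first condition on \<open>key\<close> says that its level sets are closed under
  exchanging coordinates, which makes them rectangles. Counting labels then replaces handling a
  partition.\<close>

lemma partition_number_le_card_key:
  assumes fin: "finite X" "finite Y"
    and rect: "\<And>x y x' y'. x \<in> X \<Longrightarrow> y \<in> Y \<Longrightarrow> x' \<in> X \<Longrightarrow> y' \<in> Y \<Longrightarrow> key x y' = key x' y \<Longrightarrow>
      key x y = key x y'"
    and mono: "\<And>x y x' y'. x \<in> X \<Longrightarrow> y \<in> Y \<Longrightarrow> x' \<in> X \<Longrightarrow> y' \<in> Y \<Longrightarrow> key x y = key x' y' \<Longrightarrow>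
      F x y = F x' y'"
  shows "partition_number X Y F \<le> card ((\<lambda>(x, y). key x y) ` (X \<times> Y))"
proof -
  define K where "K = (\<lambda>(x, y). key x y) ` (X \<times> Y)"
  define E where "E k = {(x, y). x \<in> X \<and> y \<in> Y \<and> key x y = k}" for k
  have finK: "finite K" using fin by (simp add: K_def)
  have ne: "E k \<noteq> {}" if "k \<in> K" for k using that by (auto simp: K_def E_def)
  have "inj_on E K"
  proof (rule inj_onI)
    fix k k' assume "k \<in> K" "E k = E k'"
    then obtain p where "p \<in> E k" "p \<in> E k'" using ne by blast
    then show "k = k'" by (auto simp: E_def)
  qed
  then have card: "card (E ` K) = card K" by (rule card_image)
  have "partition_on (X \<times> Y) (E ` K)"
  proof (rule partition_onI)
    show "\<Union> (E ` K) = X \<times> Y" by (auto simp: E_def K_def)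
    show "{} \<notin> E ` K" using ne by blast
    show "disjnt R R'" if R: "R \<in> E ` K" "R' \<in> E ` K" "R \<noteq> R'" for R R'
    proof -
      obtain k k' where "R = E k" "R' = E k'" "k \<noteq> k'" using R by blast
      then show ?thesis by (auto simp: disjnt_def E_def)
    qed
  qed
  moreover have "monochromatic_rectangle X Y F R" if R: "R \<in> E ` K" for R
  proof -
    obtain k where k: "k \<in> K" "R = E k" using R by blast
    obtain x0 y0 where 0: "(x0, y0) \<in> E k" using ne[OF k(1)] by (metis ex_in_conv surj_pair)
    have prod: "E k = fst ` E k \<times> snd ` E k"
    proof
      show "fst ` E k \<times> snd ` E k \<subseteq> E k"
      proof clarify
        fix x y' x' y assume "(x, y') \<in> E k" "(x', y) \<in> E k"
        then have *: "x \<in> X" "y \<in> Y" "x' \<in> X" "y' \<in> Y" "key x y' = k" "key x' y = k"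
          by (auto simp: E_def)
        then have "key x y = k" using rect[OF *(1-4)] by simp
        then show "(fst (x, y'), snd (x', y)) \<in> E k" using * by (simp add: E_def)
      qed
    qed force
    have "F x y = F x0 y0" if "x \<in> fst ` E k" "y \<in> snd ` E k" for x y
    proof -
      have "(x, y) \<in> E k" by (subst prod) (use that in simp)
      then show ?thesis using 0 by (intro mono) (auto simp: E_def)
    qed
    moreover have "fst ` E k \<subseteq> X" "snd ` E k \<subseteq> Y" by (auto simp: E_def)
    ultimately show ?thesis using prod unfolding monochromatic_rectangle_def k(2) by blast
  qed
  ultimately have "\<exists>\<R>. finite \<R> \<and> card \<R> = card K \<and> partition_on (X \<times> Y) \<R> \<and>
      (\<forall>R\<in>\<R>. monochromatic_rectangle X Y F R)"
    using finK card by (intro exI[of _ "E ` K"]) simp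
  then show ?thesis unfolding partition_number_def K_def by (rule Least_le)
qed

text \<open>The rectangles are tried in turn. This crude protocol shows that \<open>Dcc\<close>
  minimises over a nonempty set, and its linear bound later forces the partition numbers to
  grow.\<close>

fun rectangle_protocol :: "('a set \<times> 'b set \<times> bool) list \<Rightarrow> ('a, 'b) protocol" where
  "rectangle_protocol [] = Output False"
| "rectangle_protocol ((A, B, c) # rs) =
     Alice (\<lambda>x. x \<in> A) (Bob (\<lambda>y. y \<in> B) (Output c) (rectangle_protocol rs)) (rectangle_protocol rs)"

lemma run_rectangle_protocol:
  assumes "\<exists>(A, B, c)\<in>set rs. x \<in> A \<and> y \<in> B" "\<forall>(A, B, c)\<in>set rs. x \<in> A \<and> y \<in> B \<longrightarrow> c = b"
  shows "run (rectangle_protocol rs) x y = b"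
  using assms
proof (induction rs rule: rectangle_protocol.induct)
  case (2 A B c rs)
  show ?case
  proof (cases "x \<in> A \<and> y \<in> B")
    case True then show ?thesis using 2(4) by simp
  next
    case False
    then have "\<exists>(A, B, c)\<in>set rs. x \<in> A \<and> y \<in> B" using 2(3) by auto
    then have "run (rectangle_protocol rs) x y = b" using 2(1,4) by simp
    then show ?thesis using False by simp
  qed
qed simp

lemma bits_rectangle_protocol: "bits (rectangle_protocol rs) x y \<le> 2 * length rs"
  by (induction rs rule: rectangle_protocol.induct) auto

lemma exists_protocol_partition_number:
  assumes "finite X" "finite Y"
  shows "\<exists>P. computes P X Y F \<and> (\<forall>x\<in>X. \<forall>y\<in>Y. bits P x y \<le> 2 * partition_number X Y F)"
proof -
  let ?ok = "\<lambda>n \<R>. finite \<R> \<and> card \<R> = n \<and> partition_on (X \<times> Y) \<R> \<and>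
    (\<forall>R\<in>\<R>. monochromatic_rectangle X Y F R)"
  \<comment> \<open>The partition into single points shows that the minimum in
    \<open>partition_number\<close> is attained.\<close>
  have "?ok (card ((\<lambda>p. {p}) ` (X \<times> Y))) ((\<lambda>p. {p}) ` (X \<times> Y))"
  proof (intro conjI ballI)
    show "partition_on (X \<times> Y) ((\<lambda>p. {p}) ` (X \<times> Y))"
      by (rule partition_onI) (auto simp: disjnt_def)
    fix R assume "R \<in> (\<lambda>p. {p}) ` (X \<times> Y)"
    then obtain x y where "R = {x} \<times> {y}" "x \<in> X" "y \<in> Y" by auto
    then show "monochromatic_rectangle X Y F R"
      unfolding monochromatic_rectangle_def by (intro exI[of _ "{x}"] exI[of _ "{y}"]) auto
  qed (use assms in auto)
  then have "\<exists>n. \<exists>\<R>. ?ok n \<R>" by blast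
  then have "\<exists>\<R>. ?ok (partition_number X Y F) \<R>"
    unfolding partition_number_def by (rule LeastI_ex)
  then obtain \<R> where R: "finite \<R>" "card \<R> = partition_number X Y F" "partition_on (X \<times> Y) \<R>"
    "\<forall>R\<in>\<R>. monochromatic_rectangle X Y F R" by blast
  have rex: "\<forall>R\<in>\<R>. \<exists>r. R = fst r \<times> fst (snd r) \<and> (\<forall>x\<in>fst r. \<forall>y\<in>fst (snd r). F x y = snd (snd r))"
  proof
    fix R assume "R \<in> \<R>"
    then have "monochromatic_rectangle X Y F R" using R(4) by blast
    then obtain A B c where "R = A \<times> B" "\<forall>x\<in>A. \<forall>y\<in>B. F x y = c"
      unfolding monochromatic_rectangle_def by (elim exE conjE)
    then show "\<exists>r. R = fst r \<times> fst (snd r) \<and> (\<forall>x\<in>fst r. \<forall>y\<in>fst (snd r). F x y = snd (snd r))"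
      by (intro exI[of _ "(A, B, c)"]) simp
  qed
  obtain r where r: "\<forall>R\<in>\<R>. R = fst (r R) \<times> fst (snd (r R)) \<and>
      (\<forall>x\<in>fst (r R). \<forall>y\<in>fst (snd (r R)). F x y = snd (snd (r R)))"
    using bchoice[OF rex] by (elim exE)
  obtain Rs where Rs: "set Rs = \<R>" "distinct Rs" using finite_distinct_list[OF R(1)] by blast
  then have len: "length (map r Rs) = partition_number X Y F" using R(2) distinct_card by fastforce
  have "run (rectangle_protocol (map r Rs)) x y = F x y" if "x \<in> X" "y \<in> Y" for x y
  proof (rule run_rectangle_protocol)
    have "(x, y) \<in> \<Union> \<R>" using R(3) that unfolding partition_on_def by blast
    then obtain R where "R \<in> \<R>" "(x, y) \<in> R" by blast
    then have "(x, y) \<in> fst (r R) \<times> fst (snd (r R))" using r by blast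
    moreover have "r R \<in> set (map r Rs)" using Rs(1) \<open>R \<in> \<R>\<close> by simp
    ultimately show "\<exists>(A, B, c)\<in>set (map r Rs). x \<in> A \<and> y \<in> B"
      by (intro bexI[of _ "r R"]) (auto simp: case_prod_beta)
    show "\<forall>(A, B, c)\<in>set (map r Rs). x \<in> A \<and> y \<in> B \<longrightarrow> c = F x y"
    proof clarify
      fix A B c assume *: "(A, B, c) \<in> set (map r Rs)" "x \<in> A" "y \<in> B"
      then obtain R where "R \<in> \<R>" "r R = (A, B, c)" using Rs(1) by auto
      then have "\<forall>x\<in>A. \<forall>y\<in>B. F x y = c" using r by fastforce
      then show "c = F x y" using * by blast
    qed
  qed
  then show ?thesis
    using bits_rectangle_protocol[of "map r Rs"] len
    by (intro exI[of _ "rectangle_protocol (map r Rs)"]) (simp add: computes_def)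
qed

lemma Dcc_protocol:
  assumes "finite X" "finite Y"
  obtains P where "computes P X Y F" "\<forall>x\<in>X. \<forall>y\<in>Y. bits P x y \<le> Dcc X Y F"
proof -
  have "\<exists>d P. computes P X Y F \<and> (\<forall>x\<in>X. \<forall>y\<in>Y. bits P x y \<le> d)"
    using exists_protocol_partition_number[OF assms] by blast
  then have "\<exists>P. computes P X Y F \<and> (\<forall>x\<in>X. \<forall>y\<in>Y. bits P x y \<le> Dcc X Y F)"
    unfolding Dcc_def by (rule LeastI_ex)
  then show thesis using that by blast
qed

lemma Dcc_le_partition_number:
  assumes "finite X" "finite Y"
  shows "Dcc X Y F \<le> 2 * partition_number X Y F"
  unfolding Dcc_def by (rule Least_le) (rule exists_protocol_partition_number[OF assms])

text \<open>Carries a protocol on inputs coded as naturals back to the function-valued inputs of the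
  simulation.\<close>

primrec relabel :: "('a \<Rightarrow> 'c) \<Rightarrow> ('b \<Rightarrow> 'd) \<Rightarrow> ('c, 'd) protocol \<Rightarrow> ('a, 'b) protocol" where
  "relabel g h (Output c) = Output c"
| "relabel g h (Alice a P Q) = Alice (a \<circ> g) (relabel g h P) (relabel g h Q)"
| "relabel g h (Bob b P Q) = Bob (b \<circ> h) (relabel g h P) (relabel g h Q)"

lemma run_relabel [simp]: "run (relabel g h P) x y = run P (g x) (h y)"
  by (induction P) auto

lemma bits_relabel [simp]: "bits (relabel g h P) x y = bits P (g x) (h y)"
  by (induction P) auto

section \<open>Lifting by the index gadget\<close>

text \<open>Bernoulli's inequality without division. With \<open>a = m - \<tau>\<close> and
  \<open>b = \<tau>\<close> it says that about \<open>m / \<tau>\<close> random entries halve the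
  chance of missing a fiber.\<close>

lemma power_add_ge_twice:
  fixes a b x :: nat
  assumes "a \<le> x * b" "0 < a"
  shows "2 * a ^ x \<le> (a + b) ^ x"
proof -
  have "(a + x * b) * a ^ x \<le> a * (a + b) ^ x" for x
  proof (induction x)
    case (Suc x)
    have "(a + Suc x * b) * a ^ Suc x \<le> (a + b) * ((a + x * b) * a ^ x)" by (simp add: algebra_simps)
    also have "\<dots> \<le> (a + b) * (a * (a + b) ^ x)" by (rule mult_le_mono2[OF Suc])
    finally show ?case by (simp add: ac_simps)
  qed simp
  moreover have "(2 * a) * a ^ x \<le> (a + x * b) * a ^ x" using assms by (intro mult_le_mono1) simp
  ultimately have "a * (2 * a ^ x) \<le> a * (a + b) ^ x" by (metis le_trans mult.assoc mult.commute)
  then show ?thesis using assms(2) by simp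
qed

lemma hard_le_bits_gadget:
  fixes m :: nat
  assumes V: "finite V" "card V \<le> 2 ^ \<nu>" and q: "q \<le> 2 ^ \<nu>" "hard f q UNIV"
    and dep: "\<And>z z'. (\<And>i. i \<in> V \<Longrightarrow> z i = z' i) \<Longrightarrow> f z = f z'"
    and m: "m = 2 ^ (10 * \<nu> + 50)"
    and P: "\<forall>x\<in>PiE V (\<lambda>_. {..<m}). \<forall>y\<in>PiE V (\<lambda>_. Pow {..<m}). run P x y = f (\<lambda>i. x i \<in> y i) \<and> bits P x y \<le> d"
  shows "q \<le> d"
proof (rule ccontr)
  assume "\<not> q \<le> d"
  define \<mu> where "\<mu> = 10 * \<nu> + 50"
  \<comment> \<open>\<open>2 * card V + d\<close> is below \<open>3 * 2 ^ \<nu>\<close>, because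
    \<open>d < q\<close> in the argument by contradiction.\<close>
  define k0 :: nat where "k0 = 2 ^ (\<nu> + 2)"
  \<comment> \<open>This is \<open>m / (16 * 2 ^ \<nu>)\<close>, as pruning demands;
    \<open>x\<close> below is \<open>m / \<tau>\<close>.\<close>
  define \<tau> :: nat where "\<tau> = 2 ^ (9 * \<nu> + 46)"
  define x :: nat where "x = 2 ^ (\<nu> + 4)"
  \<comment> \<open>The number of halvings: the union bound runs over at most
    \<open>2 ^ (2 ^ \<nu> * \<mu>)\<close> points, and the 2 leaves room for the factor 2 and
    strictness.\<close>
  define s :: nat where "s = 2 ^ \<nu> * \<mu> + 2"
  define r where "r = x * s"
  \<comment> \<open>With the convenient choice \<open>c = m\<close>, the last constraint holds with
    equality.\<close>
  define K where "K = k0 + 1 + \<mu> * r"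
  have m': "m = 2 ^ \<mu>" by (simp add: m \<mu>_def)
  have x\<tau>: "x * \<tau> = m" unfolding x_def \<tau>_def m by (simp flip: power_add)
  have "16 * \<tau> * card V \<le> 16 * \<tau> * 2 ^ \<nu>" using V by simp
  also have "\<dots> = m" unfolding x\<tau>[symmetric] x_def by (simp add: power_add)
  finally have prune: "16 * \<tau> * card V \<le> m" .
  have "\<tau> < m" unfolding \<tau>_def m by simp
  then have mt: "0 < m - \<tau>" "m - \<tau> + \<tau> = m" by auto
  have "2 * (m - \<tau>) ^ x \<le> m ^ x"
    using power_add_ge_twice[of "m - \<tau>" x \<tau>] mt x\<tau> by simp
  then have "(2 * (m - \<tau>) ^ x) ^ s \<le> (m ^ x) ^ s" by (rule power_mono) simp
  then have shrink: "2 ^ s * (m - \<tau>) ^ r \<le> m ^ r" by (simp add: power_mult_distrib r_def flip: power_mult)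
  have "m ^ card V \<le> m ^ 2 ^ \<nu>" using V m by (intro power_increasing) simp_all
  also have "\<dots> = 2 ^ (2 ^ \<nu> * \<mu>)" by (simp add: m' mult.commute flip: power_mult)
  finally have "2 * (m ^ card V * (m - \<tau>) ^ r) \<le> 2 * (2 ^ (2 ^ \<nu> * \<mu>) * (m - \<tau>) ^ r)" by simp
  also have "\<dots> < 2 ^ s * (m - \<tau>) ^ r" using mt(1) by (simp add: s_def)
  also note shrink
  finally have hitA: "2 * (m ^ card V * (m - \<tau>) ^ r) < m ^ r" .
  have two: "(2::nat) \<le> 2 ^ \<nu> * \<mu>" unfolding \<mu>_def
    by (rule order_trans[of _ "1 * (10 * \<nu> + 50)"]) (simp, intro mult_le_mono1, simp)
  have "10 * a \<le> 2 ^ 4 * b" if "a < b" for a b :: nat using that by simp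
  from this[OF less_exp[of "\<nu> + 5"]] have "10 * (\<nu> + 5) \<le> 2 ^ 4 * 2 ^ (\<nu> + 5)" .
  then have \<mu>: "\<mu> \<le> 2 ^ (\<nu> + 9)" by (simp add: \<mu>_def power_add)
  have "s \<le> 2 * (2 ^ \<nu> * \<mu>)" using two unfolding s_def by linarith
  also have "\<dots> \<le> 2 * (2 ^ \<nu> * 2 ^ (\<nu> + 9))" using \<mu> by simp
  finally have "r \<le> x * (2 * (2 ^ \<nu> * 2 ^ (\<nu> + 9)))" by (simp add: r_def)
  also have "\<dots> = 2 ^ ((\<nu> + 4) + (1 + (\<nu> + (\<nu> + 9))))"
    unfolding x_def power_add[of 2 "\<nu> + 4"] power_add[of 2 1] power_add[of 2 \<nu> "\<nu> + 9"] by simp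
  also have "(\<nu> + 4) + (1 + (\<nu> + (\<nu> + 9))) = 3 * \<nu> + 14" by simp
  finally have r: "r \<le> 2 ^ (3 * \<nu> + 14)" .
  have "0 < r" by (simp add: r_def x_def s_def)
  then have "1 \<le> r" "1 \<le> \<mu>" by (simp_all add: \<mu>_def)
  have "k0 + 3 \<le> x" by (simp add: k0_def x_def power_add)
  also have "\<dots> \<le> r" by (simp add: r_def s_def)
  also have "\<dots> \<le> \<mu> * r" using \<open>1 \<le> \<mu>\<close> by simp
  finally have K: "K + 2 \<le> 2 * (\<mu> * r)" by (simp add: K_def)
  have e: "4 * (2 ^ i * (2 * (2 ^ j * 2 ^ i))) = (2 :: nat) ^ (2 + i + 1 + j + i)" for i j
    by (simp add: power_add)
  have "4 * (r * (K + 1)) \<le> 4 * (r * (2 * (\<mu> * r)))" using K by (intro mult_le_mono2) linarith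
  also have "\<dots> \<le> 4 * (2 ^ (3 * \<nu> + 14) * (2 * (2 ^ (\<nu> + 9) * 2 ^ (3 * \<nu> + 14))))"
    using r \<mu> by (intro mult_le_mono) simp_all
  also have "\<dots> = 2 ^ (2 + (3 * \<nu> + 14) + 1 + (\<nu> + 9) + (3 * \<nu> + 14))" by (rule e)
  also have "\<dots> \<le> m" unfolding m by (intro power_increasing) simp_all
  finally have hitB1: "4 * (r * (K + 1)) \<le> m" .
  have "4 * (1 * (K + 1)) \<le> 4 * (r * (K + 1))" by (intro mult_le_mono2 mult_le_mono1 \<open>1 \<le> r\<close>)
  from order_trans[OF this hitB1] have hitB2: "2 * (K + 2) \<le> m" by simp
  have hitB3: "2 ^ (k0 + 1) * m ^ r \<le> 2 ^ K" by (simp add: K_def m' power_add power_mult)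
  interpret simulation V m \<tau> r K m k0
    using V(1) prune hitA hitB1 hitB2 hitB3 mt by unfold_locales auto
  have "2 * card V + d \<le> k0" using V(2) q(1) \<open>\<not> q \<le> d\<close> by (simp add: k0_def)
  then show False using hard_le_bits[OF dep q(2) _ P] \<open>\<not> q \<le> d\<close> by blast
qed

text \<open>Each rectangle is labelled by an unambiguous certificate together with Alice's pointers
  at its variables. Alice checks the pointers, Bob the literals at them. A labelled literal or
  padding has at most \<open>2 ^ \<nu> * 2 * m + 1\<close> values, which gives the exponent
  \<open>11 * \<nu> + 52\<close>.\<close>

lemma exists_lifted_function:
  assumes V: "finite V" "card V \<le> 2 ^ \<nu>" and q: "q \<le> 2 ^ \<nu>" "hard f q UNIV"
    and una: "unambiguous f V u u"
  shows "\<exists>(X :: nat set) (Y :: nat set) F. finite X \<and> X \<noteq> {} \<and> finite Y \<and> Y \<noteq> {} \<and> q \<le> Dcc X Y F \<and>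
    partition_number X Y F \<le> 2 ^ ((11 * \<nu> + 52) * u)"
proof -
  define m :: nat where "m = 2 ^ (10 * \<nu> + 50)"
  let ?X = "PiE V (\<lambda>_. {..<m})" and ?Y = "PiE V (\<lambda>_. Pow {..<m})"
  obtain c where c: "\<And>z. sat z (c z)" "\<And>z. fst ` set (c z) \<subseteq> V"
    "\<And>z. length (c z) \<le> (if f z then u else u)" "\<And>z z'. sat z' (c z) \<Longrightarrow> f z' = f z \<and> c z' = c z"
    using unambiguousE[OF una] by blast
  have dep: "f z = f z'" if "\<And>i. i \<in> V \<Longrightarrow> z i = z' i" for z z'
  proof -
    have "sat z (c z')" using c(1)[of z'] c(2)[of z'] that by (force simp: sat_def)
    then show ?thesis using c(4) by blast
  qed
  have fin: "finite ?X" "finite ?Y" using V(1) by (auto intro: finite_PiE)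
  have "0 < m" by (simp add: m_def)
  then have ne: "?X \<noteq> {}" "?Y \<noteq> {}" by (auto simp: PiE_eq_empty_iff)
  obtain g :: "(nat \<Rightarrow> nat) \<Rightarrow> nat" where g: "inj_on g ?X" using finite_imp_inj_to_nat_seg[OF fin(1)] by blast
  obtain h :: "(nat \<Rightarrow> nat set) \<Rightarrow> nat" where h: "inj_on h ?Y" using finite_imp_inj_to_nat_seg[OF fin(2)] by blast
  define \<alpha> where "\<alpha> = inv_into ?X g"
  define \<beta> where "\<beta> = inv_into ?Y h"
  define X where "X = g ` ?X"
  define Y where "Y = h ` ?Y"
  define F where "F a b = f (\<lambda>i. \<alpha> a i \<in> \<beta> b i)" for a b
  have \<alpha>: "\<alpha> (g x) = x" if "x \<in> ?X" for x using g that by (simp add: \<alpha>_def)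
  have \<beta>: "\<beta> (h y) = y" if "y \<in> ?Y" for y using h that by (simp add: \<beta>_def)
  have finXY: "finite X" "finite Y" using fin by (simp_all add: X_def Y_def)
  have "q \<le> Dcc X Y F"
  proof -
    obtain P where P: "computes P X Y F" "\<forall>x\<in>X. \<forall>y\<in>Y. bits P x y \<le> Dcc X Y F"
      using Dcc_protocol[OF finXY] by blast
    show ?thesis
    proof (rule hard_le_bits_gadget[OF V q dep m_def, of "relabel g h P"], assumption, intro ballI)
      fix x y assume "x \<in> ?X" "y \<in> ?Y"
      then have "g x \<in> X" "h y \<in> Y" "\<alpha> (g x) = x" "\<beta> (h y) = y" by (auto simp: X_def Y_def \<alpha> \<beta>)
      then show "run (relabel g h P) x y = f (\<lambda>i. x i \<in> y i) \<and> bits (relabel g h P) x y \<le> Dcc X Y F"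
        using P by (simp add: computes_def F_def)
    qed
  qed
  moreover have "partition_number X Y F \<le> 2 ^ ((11 * \<nu> + 52) * u)"
  proof -
    define z where "z a b i \<longleftrightarrow> \<alpha> a i \<in> \<beta> b i" for a b i
    define key where "key a b = map (\<lambda>(i, v). ((i, v), \<alpha> a i)) (c (z a b))" for a b
    have key_fst: "map fst (key a b) = c (z a b)" for a b
      by (simp add: key_def case_prod_beta comp_def)
    have key_eq: "c (z a b) = c (z a' b')" "\<And>i v. (i, v) \<in> set (c (z a b)) \<Longrightarrow> \<alpha> a i = \<alpha> a' i"
      if "key a b = key a' b'" for a b a' b'
    proof -
      show e: "c (z a b) = c (z a' b')" using that key_fst by metis
      show "\<alpha> a i = \<alpha> a' i" if i: "(i, v) \<in> set (c (z a b))" for i v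
        using \<open>key a b = key a' b'\<close> i unfolding key_def e by (auto simp: map_eq_conv)
    qed
    have "partition_number X Y F \<le> card ((\<lambda>(a, b). key a b) ` (X \<times> Y))"
    proof (rule partition_number_le_card_key[OF finXY])
      fix a b a' b' assume k: "key a b' = key a' b"
      \<comment> \<open>Since \<open>a\<close> and \<open>a'\<close> point to the same places on the
        common certificate, \<open>b\<close> makes its literals true for \<open>a\<close> as it does
        for \<open>a'\<close>. Unambiguity then makes it the certificate of
        \<open>z a b\<close>.\<close>
      have "sat (z a b) (c (z a b'))"
        using c(1)[of "z a' b"] key_eq(2)[OF k] unfolding key_eq(1)[OF k, symmetric]
        by (fastforce simp: sat_def z_def)
      then have "c (z a b) = c (z a b')" using c(4) by blast
      then show "key a b = key a b'" by (simp add: key_def)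
    next
      fix a b a' b' assume k: "key a b = key a' b'"
      have "sat (z a b) (c (z a' b'))" using c(1)[of "z a b"] key_eq(1)[OF k] by simp
      then show "F a b = F a' b'" using c(4) by (simp add: F_def z_def[abs_def])
    qed
    also have "\<dots> \<le> card {k. set k \<subseteq> (V \<times> (UNIV :: bool set)) \<times> {..<m} \<and> length k \<le> u}"
    proof (rule card_mono)
      show "finite {k. set k \<subseteq> (V \<times> (UNIV :: bool set)) \<times> {..<m} \<and> length k \<le> u}"
        using V(1) by (intro finite_lists_length_le) simp
      show "(\<lambda>(a, b). key a b) ` (X \<times> Y) \<subseteq> {k. set k \<subseteq> (V \<times> (UNIV :: bool set)) \<times> {..<m} \<and> length k \<le> u}"
      proof clarify
        fix a b assume "a \<in> X"
        then have "\<alpha> a \<in> ?X" by (auto simp: X_def \<alpha>)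
        moreover have "i \<in> V" if "(i, v) \<in> set (c (z a b))" for i v using c(2)[of "z a b"] that by force
        ultimately show "set (key a b) \<subseteq> (V \<times> UNIV) \<times> {..<m} \<and> length (key a b) \<le> u"
          using c(3)[of "z a b"] by (auto simp: key_def dest: PiE_mem)
      qed
    qed
    also have "\<dots> \<le> (card ((V \<times> (UNIV :: bool set)) \<times> {..<m}) + 1) ^ u"
      using V(1) by (intro card_lists_length_le_power) simp
    also have "\<dots> \<le> (2 ^ (11 * \<nu> + 52)) ^ u"
    proof (rule power_mono)
      have "card ((V \<times> (UNIV :: bool set)) \<times> {..<m}) + 1 \<le> 2 ^ \<nu> * 2 * m + 1"
        using V(2) by (simp add: card_cartesian_product)
      also have "\<dots> \<le> 2 * (2 ^ \<nu> * 2 * m)" using \<open>0 < m\<close> by simp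
      also have "\<dots> = 2 ^ (2 + \<nu> + (10 * \<nu> + 50))" unfolding m_def power_add by simp
      also have "\<dots> = 2 ^ (11 * \<nu> + 52)" by (rule arg_cong[where f = "(^) 2"]) simp
      finally show "card ((V \<times> (UNIV :: bool set)) \<times> {..<m}) + 1 \<le> 2 ^ (11 * \<nu> + 52)" .
    qed simp
    finally show ?thesis by (simp only: power_mult)
  qed
  ultimately show ?thesis using finXY ne by (intro exI[of _ X] exI[of _ Y] exI[of _ F]) (simp add: X_def Y_def)
qed

section \<open>The amplified family\<close>

text \<open>The argument is \<open>l\<close> with \<open>n = 2 ^ l\<close>, so this means
  polylogarithmic in \<open>n\<close>, and \<open>exp_bounded\<close> means polynomial in
  \<open>n\<close>.\<close>

definition poly_bounded :: "(nat \<Rightarrow> nat) \<Rightarrow> bool" where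
  "poly_bounded h \<longleftrightarrow> (\<exists>a b. \<forall>l. h l \<le> a * (l + 1) ^ b)"

definition exp_bounded :: "(nat \<Rightarrow> nat) \<Rightarrow> bool" where
  "exp_bounded h \<longleftrightarrow> (\<exists>a. \<forall>l. h l \<le> 2 ^ (a * (l + 1)))"

lemma poly_bounded_const: "poly_bounded (\<lambda>_. c)"
  unfolding poly_bounded_def by (intro exI[of _ c] exI[of _ 0]) simp

lemma poly_bounded_ident: "poly_bounded (\<lambda>l. l)"
  unfolding poly_bounded_def by (intro exI[of _ 1] exI[of _ 1]) simp

lemma poly_bounded_add:
  assumes "poly_bounded g" "poly_bounded h" shows "poly_bounded (\<lambda>l. g l + h l)"
proof -
  obtain a b where g: "\<And>l. g l \<le> a * (l + 1) ^ b" using assms(1) unfolding poly_bounded_def by blast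
  obtain c d where h: "\<And>l. h l \<le> c * (l + 1) ^ d" using assms(2) unfolding poly_bounded_def by blast
  have "g l + h l \<le> (a + c) * (l + 1) ^ (b + d)" for l
  proof -
    have "a * (l + 1) ^ b \<le> a * (l + 1) ^ (b + d)" "c * (l + 1) ^ d \<le> c * (l + 1) ^ (b + d)"
      by (intro mult_le_mono2 power_increasing; simp)+
    then have "a * (l + 1) ^ b + c * (l + 1) ^ d \<le> (a + c) * (l + 1) ^ (b + d)"
      unfolding distrib_right by (rule add_mono)
    then show ?thesis using g[of l] h[of l] by linarith
  qed
  then show ?thesis unfolding poly_bounded_def by blast
qed

lemma poly_bounded_mult:
  assumes "poly_bounded g" "poly_bounded h" shows "poly_bounded (\<lambda>l. g l * h l)"
proof -
  obtain a b where g: "\<And>l. g l \<le> a * (l + 1) ^ b" using assms(1) unfolding poly_bounded_def by blast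
  obtain c d where h: "\<And>l. h l \<le> c * (l + 1) ^ d" using assms(2) unfolding poly_bounded_def by blast
  have "g l * h l \<le> (a * c) * (l + 1) ^ (b + d)" for l
  proof -
    have "g l * h l \<le> (a * (l + 1) ^ b) * (c * (l + 1) ^ d)" by (rule mult_le_mono[OF g h])
    also have "\<dots> = (a * c) * (l + 1) ^ (b + d)" unfolding power_add by (simp only: ac_simps)
    finally show ?thesis .
  qed
  then show ?thesis unfolding poly_bounded_def by blast
qed

lemma exp_bounded_mult:
  assumes "exp_bounded g" "exp_bounded h" shows "exp_bounded (\<lambda>l. g l * h l)"
proof -
  obtain a where g: "\<And>l. g l \<le> 2 ^ (a * (l + 1))" using assms(1) unfolding exp_bounded_def by blast
  obtain c where h: "\<And>l. h l \<le> 2 ^ (c * (l + 1))" using assms(2) unfolding exp_bounded_def by blast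
  have "g l * h l \<le> 2 ^ ((a + c) * (l + 1))" for l
  proof -
    have "g l * h l \<le> 2 ^ (a * (l + 1)) * 2 ^ (c * (l + 1))" by (rule mult_le_mono[OF g h])
    also have "\<dots> = 2 ^ ((a + c) * (l + 1))" unfolding distrib_right[of a c] by (rule power_add[symmetric])
    finally show ?thesis .
  qed
  then show ?thesis unfolding exp_bounded_def by blast
qed

lemma exp_bounded_add:
  assumes "exp_bounded g" "exp_bounded h" shows "exp_bounded (\<lambda>l. g l + h l)"
proof -
  obtain a where g: "\<And>l. g l \<le> 2 ^ (a * (l + 1))" using assms(1) unfolding exp_bounded_def by blast
  obtain c where h: "\<And>l. h l \<le> 2 ^ (c * (l + 1))" using assms(2) unfolding exp_bounded_def by blast
  have "g l + h l \<le> 2 ^ ((a + c + 1) * (l + 1))" for l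
  proof -
    have "(2::nat) ^ (a * (l + 1)) \<le> 2 ^ ((a + c) * (l + 1))" "(2::nat) ^ (c * (l + 1)) \<le> 2 ^ ((a + c) * (l + 1))"
      by (intro power_increasing mult_le_mono1; simp)+
    then have "g l + h l \<le> 2 * 2 ^ ((a + c) * (l + 1))" using g[of l] h[of l] by linarith
    also have "\<dots> = 2 ^ Suc ((a + c) * (l + 1))" by simp
    also have "\<dots> \<le> 2 ^ ((a + c + 1) * (l + 1))" by (intro power_increasing) simp_all
    finally show ?thesis .
  qed
  then show ?thesis unfolding exp_bounded_def by blast
qed

lemma exp_bounded_power2: "exp_bounded (\<lambda>l. 2 ^ (c * l + d))"
  unfolding exp_bounded_def by (intro exI[of _ "c + d"] allI power_increasing) (simp_all add: algebra_simps)

lemma exp_bounded_poly: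
  assumes "poly_bounded h" shows "exp_bounded h"
proof -
  obtain a b where h: "\<And>l. h l \<le> a * (l + 1) ^ b" using assms(1) unfolding poly_bounded_def by blast
  have "h l \<le> 2 ^ ((a + b) * (l + 1))" for l
  proof -
    have "a \<le> 2 ^ a" by (rule less_imp_le[OF less_exp])
    moreover have "(l + 1) ^ b \<le> (2 ^ (l + 1)) ^ b" by (intro power_mono less_imp_le[OF less_exp]) simp
    ultimately have "a * (l + 1) ^ b \<le> 2 ^ a * (2 ^ (l + 1)) ^ b" by (rule mult_le_mono)
    also have "\<dots> = 2 ^ (a + (l + 1) * b)" unfolding power_add power_mult ..
    also have "\<dots> \<le> 2 ^ ((a + b) * (l + 1))" by (intro power_increasing) (simp_all add: algebra_simps)
    finally show ?thesis using h[of l] by linarith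
  qed
  then show ?thesis unfolding exp_bounded_def by blast
qed

text \<open>A single \<open>l\<close> suffices for each \<open>k\<close>. Taking \<open>l\<close>
  itself as a power of 2 reduces the comparison to exponents.\<close>

lemma poly_bounded_le_power2:
  assumes "poly_bounded h" shows "\<exists>l\<ge>1. h l \<le> 2 ^ l"
proof -
  obtain a b where h: "\<And>l. h l \<le> a * (l + 1) ^ b" using assms(1) unfolding poly_bounded_def by blast
  define c where "c = a + b"
  define j where "j = 2 * c + 4"
  define l :: nat where "l = 2 ^ j"
  have "l + 1 \<le> 2 ^ (j + 1)" by (simp add: l_def)
  then have "(l + 1) ^ b \<le> (2 ^ (j + 1)) ^ b" by (rule power_mono) simp
  moreover have "a \<le> 2 ^ a" by (rule less_imp_le[OF less_exp])
  ultimately have "a * (l + 1) ^ b \<le> 2 ^ a * (2 ^ (j + 1)) ^ b" by (intro mult_le_mono)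
  also have "\<dots> = 2 ^ (a + (j + 1) * b)" unfolding power_add power_mult ..
  also have "\<dots> \<le> 2 ^ l"
  proof (rule power_increasing)
    have "2 * x + 6 \<le> 16 * y" if "x < y" for x y :: nat using that by simp
    from this[OF less_exp[of c]] have c: "2 * c + 6 \<le> 16 * 2 ^ c" .
    have "a + (j + 1) * b \<le> (a + b) * (j + 1) + (a + b)" by (simp add: algebra_simps)
    also have "\<dots> = c * (2 * c + 6)" unfolding c_def[symmetric] by (simp add: j_def algebra_simps)
    also have "\<dots> \<le> 2 ^ c * (16 * 2 ^ c)" using c by (intro mult_le_mono less_imp_le[OF less_exp])
    also have "\<dots> = 2 ^ (c + (4 + c))" unfolding power_add by simp
    also have "\<dots> = l" unfolding l_def j_def by (rule arg_cong[where f = "(^) 2"]) simp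
    finally show "a + (j + 1) * b \<le> l" .
  qed simp
  finally have "h l \<le> 2 ^ l" using h[of l] by linarith
  moreover have "1 \<le> l" by (simp add: l_def)
  ultimately show ?thesis by blast
qed

text \<open>Composing twice with NAND is an OR of ANDs.\<close>

lemma amplify:
  assumes V: "finite V" "2 * card V + 1 \<le> 2 ^ L" and t: "0 < t" "q \<le> 2 ^ t" and n: "0 < n" "0 < q"
    and f: "certifiable f V w w" "unambiguous f V u u" "hard f q UNIV"
  shows "\<exists>f' V'. finite V' \<and> card V' \<le> n * (n * (t * card V + 2 ^ t * (t * w * L))) \<and>
    hard f' (n * (n * q)) UNIV \<and> certifiable f' V' (n * (t * w * (L + 2))) (n * (t * w * (L + 2))) \<and>
    unambiguous f' V' (n * (n * (t * w * (L + 1)) + (t * u + t * w * (L + 1))) + n * (n * (t * w * (L + 1))))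
      (n * (n * (t * w * (L + 1)) + (t * u + t * w * (L + 1))) + n * (n * (t * w * (L + 1))))"
proof -
  obtain g W where g: "finite W" "card W \<le> t * card V + 2 ^ t * (t * w * L)" "hard g q UNIV"
    "certifiable g W (t * w * (L + 2)) (t * w * (L + 2))"
    "unambiguous g W (t * u + t * w * (L + 1)) (t * w * (L + 1))"
    using exists_cheat_sheet[OF V t f] by blast
  let ?f = "nand n (nand n g)" and ?V = "block_vars n (block_vars n W)"
  have "finite ?V" using g(1) by (intro finite_block_vars)
  moreover have "card ?V \<le> n * (n * (t * card V + 2 ^ t * (t * w * L)))"
    using g(2) by (intro order_trans[OF card_block_vars_le] mult_le_mono2 finite_block_vars g(1)) auto
  moreover have "hard ?f (n * (n * q)) UNIV" using n by (intro hard_nand g(3)) simp_all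
  moreover have "certifiable ?f ?V (n * (t * w * (L + 2))) (n * (t * w * (L + 2)))"
    by (intro certifiable_nand g(4))
  moreover have "unambiguous ?f ?V (n * (n * (t * w * (L + 1)) + (t * u + t * w * (L + 1))) + n * (n * (t * w * (L + 1))))
      (n * (n * (t * w * (L + 1)) + (t * u + t * w * (L + 1))) + n * (n * (t * w * (L + 1))))"
    by (rule unambiguous_mono[OF unambiguous_nand[OF unambiguous_nand[OF g(5)]]]) (use n in simp_all)
  ultimately show ?thesis by blast
qed

text \<open>The situation after \<open>k\<close> rounds: \<open>p\<close> collects the
  polylogarithmic factors, and \<open>N\<close> bounds the number of variables, on which the gadget
  size depends.\<close>

definition query_gap :: "nat \<Rightarrow> nat \<Rightarrow> nat \<Rightarrow> nat \<Rightarrow> bool" where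
  "query_gap n k p N \<longleftrightarrow> (\<exists>f V. finite V \<and> card V \<le> N \<and> hard f (n ^ (2 * k)) UNIV \<and>
     certifiable f V (p * n ^ k) (p * n ^ k) \<and> unambiguous f V (p * n ^ (k + 1)) (p * n ^ (k + 1)))"

lemma query_gap_0:
  assumes "0 < n" shows "query_gap n 0 1 1"
proof -
  let ?f = "\<lambda>z :: nat \<Rightarrow> bool. z 0" and ?c = "\<lambda>z :: nat \<Rightarrow> bool. [(0 :: nat, z 0)]"
  have "certifiable ?f {0} 1 1" by (rule certifiableI[of ?c]) (simp_all add: sat_def)
  moreover have "unambiguous ?f {0} 1 1" by (rule unambiguousI[of ?c]) (simp_all add: sat_def)
  then have "unambiguous ?f {0} n n" by (rule unambiguous_mono) (use assms in simp_all)
  moreover have "hard ?f (Suc 0) UNIV"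
    by (simp, intro conjI exI[of _ "\<lambda>_. True"] exI[of _ "\<lambda>_. False"]) simp_all
  ultimately show ?thesis
    unfolding query_gap_def by (intro exI[of _ ?f] exI[of _ "{0 :: nat}"]) simp
qed

lemma query_gap_Suc:
  assumes gap: "query_gap n k p N" and n: "0 < n" and L: "2 * N + 1 \<le> 2 ^ L" and t: "0 < t" "n ^ (2 * k) \<le> 2 ^ t"
  shows "query_gap n (Suc k) (4 * (t * (L + 2)) * p) (n * (n * (t * N + 2 ^ t * (t * (p * n ^ k) * L))))"
proof -
  obtain f V where f: "finite V" "card V \<le> N" "hard f (n ^ (2 * k)) UNIV"
    "certifiable f V (p * n ^ k) (p * n ^ k)" "unambiguous f V (p * n ^ (k + 1)) (p * n ^ (k + 1))"
    using gap unfolding query_gap_def by blast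
  define w where "w = p * n ^ k"
  define u where "u = p * n ^ (k + 1)"
  have "2 * card V + 1 \<le> 2 ^ L" "0 < n ^ (2 * k)" using f(2) L n by simp_all
  then obtain f' V' where f': "finite V'" "card V' \<le> n * (n * (t * card V + 2 ^ t * (t * w * L)))"
    "hard f' (n * (n * n ^ (2 * k))) UNIV" "certifiable f' V' (n * (t * w * (L + 2))) (n * (t * w * (L + 2)))"
    "unambiguous f' V' (n * (n * (t * w * (L + 1)) + (t * u + t * w * (L + 1))) + n * (n * (t * w * (L + 1))))
      (n * (n * (t * w * (L + 1)) + (t * u + t * w * (L + 1))) + n * (n * (t * w * (L + 1))))"
    using amplify[OF f(1) _ t n _ f(4,5,3)] unfolding w_def u_def by blast
  have "n * (n * (t * card V + 2 ^ t * (t * w * L))) \<le> n * (n * (t * N + 2 ^ t * (t * w * L)))"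
    using f(2) by (intro mult_le_mono2 add_mono) simp_all
  then have "card V' \<le> n * (n * (t * N + 2 ^ t * (t * (p * n ^ k) * L)))"
    using f'(2) unfolding w_def by linarith
  moreover have "hard f' (n ^ (2 * Suc k)) UNIV" using f'(3) by (simp add: mult.assoc)
  moreover have "certifiable f' V' (4 * (t * (L + 2)) * p * n ^ Suc k) (4 * (t * (L + 2)) * p * n ^ Suc k)"
    by (rule certifiable_mono[OF f'(4)]) (simp_all add: w_def algebra_simps)
  moreover have "n * (n * (t * w * (L + 1)) + (t * u + t * w * (L + 1))) + n * (n * (t * w * (L + 1)))
      \<le> 4 * (t * (L + 2)) * p * n ^ (Suc k + 1)"
  proof -
    have "n * (t * w * (L + 1)) \<le> n * (n * (t * w * (L + 1)))" using n by simp
    then have "n * (n * (t * w * (L + 1)) + (t * u + t * w * (L + 1))) + n * (n * (t * w * (L + 1)))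
      \<le> 3 * (n * (n * (t * w * (L + 1)))) + n * (t * u)" unfolding distrib_left[of n] by linarith
    also have "\<dots> \<le> 4 * (t * (L + 2)) * p * n ^ (Suc k + 1)" by (simp add: w_def u_def algebra_simps)
    finally show ?thesis .
  qed
  then have "unambiguous f' V' (4 * (t * (L + 2)) * p * n ^ (Suc k + 1)) (4 * (t * (L + 2)) * p * n ^ (Suc k + 1))"
    using unambiguous_mono[OF f'(5)] by blast
  ultimately show ?thesis unfolding query_gap_def using f'(1) by blast
qed

lemma exists_query_gap_family:
  "\<exists>p N. poly_bounded p \<and> exp_bounded N \<and> (\<forall>l. query_gap (2 ^ l) k (p l) (N l))"
proof (induction k)
  case 0
  show ?case
    by (rule exI[of _ "\<lambda>_. 1"], rule exI[of _ "\<lambda>_. 1"])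
      (intro conjI allI poly_bounded_const exp_bounded_poly query_gap_0, simp)
next
  case (Suc k)
  then obtain p N where p: "poly_bounded p" and N: "exp_bounded N" and gap: "\<And>l. query_gap (2 ^ l) k (p l) (N l)"
    by blast
  have "exp_bounded (\<lambda>l. 2 * N l + 1)"
    by (intro exp_bounded_add exp_bounded_mult N exp_bounded_poly poly_bounded_const)
  then obtain a where a: "\<And>l. 2 * N l + 1 \<le> 2 ^ (a * (l + 1))" unfolding exp_bounded_def by blast
  define L where "L l = a * (l + 1)" for l
  \<comment> \<open>\<open>2 * k * l\<close> is the logarithm of \<open>n ^ (2 * k)\<close>; the 1
    keeps \<open>t\<close> positive for \<open>k = 0\<close>.\<close>
  define t where "t l = 2 * k * l + 1" for l
  have L: "poly_bounded L"
    unfolding L_def by (intro poly_bounded_mult poly_bounded_add poly_bounded_const poly_bounded_ident)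
  have t: "poly_bounded t"
    unfolding t_def by (intro poly_bounded_mult poly_bounded_add poly_bounded_const poly_bounded_ident)
  let ?p = "\<lambda>l. 4 * (t l * (L l + 2)) * p l"
  let ?N = "\<lambda>l. 2 ^ l * (2 ^ l * (t l * N l + 2 ^ t l * (t l * (p l * (2 ^ l) ^ k) * L l)))"
  have "query_gap (2 ^ l) (Suc k) (?p l) (?N l)" for l
  proof (rule query_gap_Suc[OF gap])
    have "((2::nat) ^ l) ^ (2 * k) = 2 ^ (2 * k * l)" by (simp add: mult.commute flip: power_mult)
    also have "\<dots> \<le> 2 ^ t l" unfolding t_def by (intro power_increasing) simp_all
    finally show "((2::nat) ^ l) ^ (2 * k) \<le> 2 ^ t l" .
  qed (use a in \<open>simp_all add: L_def t_def\<close>)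
  moreover have "poly_bounded ?p"
    by (intro poly_bounded_mult poly_bounded_add poly_bounded_const L t p)
  moreover have "exp_bounded ?N"
  proof -
    have 1: "exp_bounded (\<lambda>l. 2 ^ l)" using exp_bounded_power2[of 1 0] by simp
    have 2: "exp_bounded (\<lambda>l. 2 ^ t l)" unfolding t_def by (rule exp_bounded_power2)
    have 3: "exp_bounded (\<lambda>l. (2 ^ l) ^ k)" using exp_bounded_power2[of k 0] by (simp add: mult.commute flip: power_mult)
    show ?thesis by (intro exp_bounded_mult exp_bounded_add 1 2 3 N exp_bounded_poly[OF t] exp_bounded_poly[OF p] exp_bounded_poly[OF L])
  qed
  ultimately show ?case by blast
qed

text \<open>The gadget cost and \<open>p l\<close> together are at most \<open>B = 2 ^ l\<close>, so
  all overhead is absorbed by raising the exponent from \<open>k + 1\<close> to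
  \<open>k + 2\<close>.\<close>

lemma exists_near_quadratic_gap:
  "\<exists>(X :: nat set) (Y :: nat set) F B. finite X \<and> X \<noteq> {} \<and> finite Y \<and> Y \<noteq> {} \<and> 2 \<le> B \<and>
    B ^ (2 * k) \<le> Dcc X Y F \<and> partition_number X Y F \<le> 2 ^ (B ^ (k + 2))"
proof -
  obtain p N where p: "poly_bounded p" and N: "exp_bounded N" and gap: "\<And>l. query_gap (2 ^ l) k (p l) (N l)"
    using exists_query_gap_family by blast
  obtain a where a: "\<And>l. N l \<le> 2 ^ (a * (l + 1))" using N unfolding exp_bounded_def by blast
  define \<nu> where "\<nu> l = (a + 2 * k) * (l + 1)" for l
  have "poly_bounded (\<lambda>l. (11 * \<nu> l + 52) * p l)"
    unfolding \<nu>_def by (intro poly_bounded_mult poly_bounded_add poly_bounded_const poly_bounded_ident p)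
  then obtain l where l: "1 \<le> l" "(11 * \<nu> l + 52) * p l \<le> 2 ^ l" using poly_bounded_le_power2 by blast
  define B :: nat where "B = 2 ^ l"
  obtain f V where f: "finite V" "card V \<le> N l" "hard f (B ^ (2 * k)) UNIV"
    "unambiguous f V (p l * B ^ (k + 1)) (p l * B ^ (k + 1))"
    using gap[of l] unfolding query_gap_def B_def by blast
  have "(2::nat) ^ (a * (l + 1)) \<le> 2 ^ \<nu> l"
    unfolding \<nu>_def by (intro power_increasing mult_le_mono1) simp_all
  then have c: "card V \<le> 2 ^ \<nu> l" using f(2) a[of l] by linarith
  have q: "B ^ (2 * k) \<le> 2 ^ \<nu> l"
    unfolding B_def \<nu>_def power_mult[symmetric] by (intro power_increasing) (simp_all add: algebra_simps)
  from exists_lifted_function[OF f(1) c q f(3,4)]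
  obtain X Y :: "nat set" and F where F: "finite X" "X \<noteq> {}" "finite Y" "Y \<noteq> {}"
    "B ^ (2 * k) \<le> Dcc X Y F" "partition_number X Y F \<le> 2 ^ ((11 * \<nu> l + 52) * (p l * B ^ (k + 1)))"
    by (elim exE conjE)
  have "(11 * \<nu> l + 52) * (p l * B ^ (k + 1)) = ((11 * \<nu> l + 52) * p l) * B ^ (k + 1)" by (simp only: mult.assoc)
  also have "\<dots> \<le> B * B ^ (k + 1)" using l(2) unfolding B_def by (rule mult_le_mono1)
  also have "\<dots> = B ^ (k + 2)" by simp
  finally have "(2::nat) ^ ((11 * \<nu> l + 52) * (p l * B ^ (k + 1))) \<le> 2 ^ (B ^ (k + 2))"
    by (intro power_increasing) simp_all
  then have "partition_number X Y F \<le> 2 ^ (B ^ (k + 2))" using F(6) by linarith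
  moreover have "2 \<le> B" unfolding B_def using l(1) power_increasing[of 1 l "2::nat"] by simp
  ultimately show ?thesis using F(1-5) by blast
qed

theorem theorem1:
  "\<exists>(X :: nat \<Rightarrow> nat set) (Y :: nat \<Rightarrow> nat set) (F :: nat \<Rightarrow> nat \<Rightarrow> nat \<Rightarrow> bool) (\<epsilon> :: nat \<Rightarrow> real).
     (\<forall>j. finite (X j) \<and> X j \<noteq> {} \<and> finite (Y j) \<and> Y j \<noteq> {}) \<and>
     filterlim (\<lambda>j. log 2 (real (partition_number (X j) (Y j) (F j)))) at_top sequentially \<and>
     \<epsilon> \<longlonglongrightarrow> 0 \<and>
     (\<forall>j. real (Dcc (X j) (Y j) (F j))
            \<ge> log 2 (real (partition_number (X j) (Y j) (F j))) powr (2 - \<epsilon> j))"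
proof -
  have "\<exists>(X :: nat set) (Y :: nat set) F B. finite X \<and> X \<noteq> {} \<and> finite Y \<and> Y \<noteq> {} \<and> 2 \<le> B \<and>
    B ^ (2 * (j + 1)) \<le> Dcc X Y F \<and> partition_number X Y F \<le> 2 ^ (B ^ (j + 1 + 2))" for j
    by (rule exists_near_quadratic_gap)
  then obtain X Y :: "nat \<Rightarrow> nat set" and F B where
    fin: "\<And>j. finite (X j) \<and> X j \<noteq> {} \<and> finite (Y j) \<and> Y j \<noteq> {}" and B: "\<And>j. 2 \<le> B j" and
    D: "\<And>j. B j ^ (2 * (j + 1)) \<le> Dcc (X j) (Y j) (F j)" and
    chi: "\<And>j. partition_number (X j) (Y j) (F j) \<le> 2 ^ (B j ^ (j + 1 + 2))"
    by metis
  let ?\<chi> = "\<lambda>j. partition_number (X j) (Y j) (F j)"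
  \<comment> \<open>With \<open>k = j + 1\<close> the ratio of the exponents is
    \<open>2 * (j + 1) / (j + 3)\<close>, which is \<open>2 - 4 / (j + 3)\<close>.\<close>
  let ?\<epsilon> = "\<lambda>j. 4 / real (j + 3)"
  \<comment> \<open>The partition numbers tend to infinity because \<open>Dcc\<close> does and is at
    most twice as large.\<close>
  have low: "2 ^ j \<le> ?\<chi> j" for j
  proof -
    have "(2::nat) * 2 ^ j \<le> 2 ^ (2 * (j + 1))" by (simp only: flip: power_Suc) (intro power_increasing, simp_all)
    also have "\<dots> \<le> B j ^ (2 * (j + 1))" using B by (intro power_mono) simp_all
    also have "\<dots> \<le> Dcc (X j) (Y j) (F j)" by (rule D)
    also have "\<dots> \<le> 2 * ?\<chi> j" using fin by (intro Dcc_le_partition_number) simp_all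
    finally show ?thesis by simp
  qed
  have pos: "0 < ?\<chi> j" for j by (rule less_le_trans[OF _ low]) simp
  have j_le: "real j \<le> log 2 (?\<chi> j)" for j
  proof -
    have "real (2 ^ j) \<le> real (?\<chi> j)" using low[of j] by (simp only: of_nat_le_iff)
    then have "2 powr real j \<le> real (?\<chi> j)" by (simp add: powr_realpow)
    then show ?thesis using pos[of j] by (simp add: le_log_iff)
  qed
  have "filterlim (\<lambda>j. log 2 (?\<chi> j)) at_top sequentially"
    by (rule filterlim_at_top_mono[OF filterlim_real_sequentially]) (simp add: j_le)
  moreover have "?\<epsilon> \<longlonglongrightarrow> 0"
    using LIMSEQ_ignore_initial_segment[OF lim_const_over_n[of 4], of 3] by simp
  moreover have "log 2 (?\<chi> j) powr (2 - ?\<epsilon> j) \<le> Dcc (X j) (Y j) (F j)" for j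
  proof -
    have Bj: "0 < real (B j)" using B[of j] by simp
    have "real (?\<chi> j) \<le> real (2 ^ (B j ^ (j + 1 + 2)))" using chi[of j] by (simp only: of_nat_le_iff)
    then have "log 2 (?\<chi> j) \<le> log 2 (2 ^ (B j ^ (j + 1 + 2)))"
      using pos[of j] by (intro log_mono) simp_all
    also have "\<dots> = real (B j ^ (j + 3))" by (simp add: log_nat_power numeral_3_eq_3)
    also have "\<dots> = real (B j) powr real (j + 3)" using Bj by (simp only: powr_realpow of_nat_power)
    finally have "log 2 (?\<chi> j) \<le> real (B j) powr real (j + 3)" .
    moreover have "0 \<le> log 2 (?\<chi> j)" using j_le[of j] by linarith
    moreover have "0 \<le> 2 - ?\<epsilon> j" by (simp add: field_simps)
    ultimately have "log 2 (?\<chi> j) powr (2 - ?\<epsilon> j) \<le> (real (B j) powr real (j + 3)) powr (2 - ?\<epsilon> j)"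
      by (intro powr_mono2)
    also have "\<dots> = real (B j) powr (real (j + 3) * (2 - ?\<epsilon> j))" by (rule powr_powr)
    also have "real (j + 3) * (2 - ?\<epsilon> j) = real (2 * (j + 1))" by (simp add: field_simps)
    also have "real (B j) powr real (2 * (j + 1)) = real (B j ^ (2 * (j + 1)))"
      using Bj by (simp only: powr_realpow of_nat_power)
    also have "\<dots> \<le> Dcc (X j) (Y j) (F j)" using D[of j] by (simp only: of_nat_le_iff)
    finally show ?thesis .
  qed
  ultimately show ?thesis
    using fin by (intro exI[of _ X] exI[of _ Y] exI[of _ F] exI[of _ ?\<epsilon>] conjI) blast+
qed

end
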